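(* Let $\Omega\subseteq\mathbb{C}$ be a simply connected open set and let $\mathcal{F}\subseteq\mathbb{N}\times\mathbb{N}$ contain a sequence $(\tilde p_n,\tilde q_n)\in\mathcal{F}$, $n=1,2,\dots$, with $\tilde p_n\to+\infty$. There exists a holomorphic function $f\in H(\Omega)$ with the following property: there exists a sequence $(p_n,q_n)\in\mathcal{F}$, $n=1,2,\dots$, such that for every compact set $K\subseteq\Omega$ there is an $n(K)\in\mathbb{N}$ so that $f\in\mathcal{D}_{p_n,q_n}(\zeta)$ for all $n\ge n(K)$ and all $\zeta\in K$, and $\sup_{\zeta\in K}\sup_{z\in K}\big|[p_n/q_n]_{f,\zeta}(z)-f(z)\big|\to 0$ as $n\to+\infty$. The set of all such functions $f\in H(\Omega)$ is a $G_\delta$ and dense subset of $H(\Omega)$ endowed with the topology of uniform convergence on compacta.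
   Context: An open set $\Omega\subseteq\mathbb{C}$ (not necessarily connected) is simply connected if $(\mathbb{C}\cup\{\infty\})\setminus\Omega$ is connected. $H(\Omega)$ is the space of holomorphic functions on $\Omega$ with the topology of uniform convergence on compact subsets of $\Omega$. Padé approximants. Degrees $p,q$ range over $\mathbb{N}=\{0,1,2,\dots\}$. Let $f=\sum_{v\ge 0}a_v(z-\zeta)^v$ be a power series centered at $\zeta\in\mathbb{C}$ (for $f$ holomorphic near $\zeta$, its Taylor series at $\zeta$). A Padé approximant $[p/q]_{f,\zeta}$ is a rational function of the form $P/Q$, $P(z)=\sum_{v=0}^p n_v(z-\zeta)^v$, $Q(z)=\sum_{v=0}^q d_v(z-\zeta)^v$ with $d_0=1$, whose Taylor coefficients $b_v$ at $\zeta$ satisfy $b_v=a_v$ for $v=0,\dots,p+q$. We write $f\in\mathcal{D}_{p,q}(\zeta)$ if the Hankel determinant $\det\big(a_{p-q+i+j-1}\big)_{i,j=1}^q$ is nonzero, with $a_i=0$ for $i<0$ (for $q=0$ the condition is always satisfied). In that case $[p/q]_{f,\zeta}$ exists and is unique (for $q=0$ it is the Taylor partial sum $\sum_{v=0}^p a_v(z-\zeta)^v$). The value of a rational function at a pole is taken to be $\infty$, so a finite supremum over $K$ means that there are no poles in $K$. *)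

theory Defs
  imports
    Jordan_Normal_Form.Determinant
    "HOL-Complex_Analysis.Complex_Analysis"
    "HOL-Computational_Algebra.Computational_Algebra"
    "HOL-Computational_Algebra.Field_as_Ring"
begin

text \<open>
  The Riemann sphere is the type \<^typ>\<open>complex option\<close> with topology
  \<^term>\<open>Alexandroff_compactification (euclidean :: complex topology)\<close>; \<^term>\<open>None\<close> is the
  point at infinity. The library's \<^const>\<open>simply_connected\<close> forces connectedness, whereas
  the following notion does not.
\<close>

definition sphere_simply_connected :: "complex set \<Rightarrow> bool" where
  "sphere_simply_connected \<Omega> \<longleftrightarrow>
     connectedin (Alexandroff_compactification euclidean) (UNIV - Some ` \<Omega>)"

text \<open>
  Elements of \<open>H(\<Omega>)\<close> are represented by functions that are \<^const>\<open>undefined\<close> off \<open>\<Omega>\<close>, so that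
  equality of representatives is equality on \<open>\<Omega>\<close>.
\<close>

definition hol_space :: "complex set \<Rightarrow> (complex \<Rightarrow> complex) set" where
  "hol_space \<Omega> = {f \<in> extensional \<Omega>. f holomorphic_on \<Omega>}"

definition hol_open :: "complex set \<Rightarrow> (complex \<Rightarrow> complex) set \<Rightarrow> bool" where
  "hol_open \<Omega> U \<longleftrightarrow> U \<subseteq> hol_space \<Omega> \<and>
     (\<forall>f\<in>U. \<exists>K \<epsilon>. compact K \<and> K \<subseteq> \<Omega> \<and> \<epsilon> > 0 \<and>
        {g \<in> hol_space \<Omega>. \<forall>z\<in>K. dist (g z) (f z) < \<epsilon>} \<subseteq> U)"

definition hol_topology :: "complex set \<Rightarrow> (complex \<Rightarrow> complex) topology" where
  "hol_topology \<Omega> = topology (hol_open \<Omega>)"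

lemma hol_open_subset: "hol_open \<Omega> U \<Longrightarrow> U \<subseteq> hol_space \<Omega>"
  unfolding hol_open_def by (erule conjunct1)

lemma istopology_hol_open: "istopology (hol_open \<Omega>)"
  unfolding istopology_def
proof (intro conjI allI impI)
  fix S T assume S: "hol_open \<Omega> S" and T: "hol_open \<Omega> T"
  show "hol_open \<Omega> (S \<inter> T)"
    unfolding hol_open_def
  proof (intro conjI ballI)
    show "S \<inter> T \<subseteq> hol_space \<Omega>" using hol_open_subset[OF S] by blast
    fix f assume f: "f \<in> S \<inter> T"
    obtain K \<epsilon> where K: "compact K" "K \<subseteq> \<Omega>" "\<epsilon> > 0"
      "{g \<in> hol_space \<Omega>. \<forall>z\<in>K. dist (g z) (f z) < \<epsilon>} \<subseteq> S"
      using S f unfolding hol_open_def by blast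
    obtain L \<delta> where L: "compact L" "L \<subseteq> \<Omega>" "\<delta> > 0"
      "{g \<in> hol_space \<Omega>. \<forall>z\<in>L. dist (g z) (f z) < \<delta>} \<subseteq> T"
      using T f unfolding hol_open_def by blast
    have "{g \<in> hol_space \<Omega>. \<forall>z\<in>K \<union> L. dist (g z) (f z) < min \<epsilon> \<delta>} \<subseteq> S \<inter> T"
      using K(4) L(4) by auto
    then show "\<exists>K \<epsilon>. compact K \<and> K \<subseteq> \<Omega> \<and> \<epsilon> > 0 \<and>
        {g \<in> hol_space \<Omega>. \<forall>z\<in>K. dist (g z) (f z) < \<epsilon>} \<subseteq> S \<inter> T"
      using K(1-3) L(1-3)
      by (intro exI[of _ "K \<union> L"] exI[of _ "min \<epsilon> \<delta>"] conjI) (simp_all add: compact_Un)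
  qed
next
  fix \<K> assume *: "\<forall>S\<in>\<K>. hol_open \<Omega> S"
  show "hol_open \<Omega> (\<Union>\<K>)"
    unfolding hol_open_def
  proof (intro conjI ballI)
    show "\<Union>\<K> \<subseteq> hol_space \<Omega>" using * hol_open_subset by blast
    fix f assume "f \<in> \<Union>\<K>"
    then obtain S where S: "S \<in> \<K>" "f \<in> S" by blast
    then have "hol_open \<Omega> S" using * by blast
    then obtain K \<epsilon> where K: "compact K" "K \<subseteq> \<Omega>" "\<epsilon> > 0"
      "{g \<in> hol_space \<Omega>. \<forall>z\<in>K. dist (g z) (f z) < \<epsilon>} \<subseteq> S"
      using S(2) unfolding hol_open_def by blast
    have "{g \<in> hol_space \<Omega>. \<forall>z\<in>K. dist (g z) (f z) < \<epsilon>} \<subseteq> \<Union>\<K>"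
      using K(4) Union_upper[OF S(1)] by (rule subset_trans)
    with K(1-3) show "\<exists>K \<epsilon>. compact K \<and> K \<subseteq> \<Omega> \<and> \<epsilon> > 0 \<and>
        {g \<in> hol_space \<Omega>. \<forall>z\<in>K. dist (g z) (f z) < \<epsilon>} \<subseteq> \<Union>\<K>"
      by (intro exI conjI)
  qed
qed

lemma openin_hol_topology: "openin (hol_topology \<Omega>) U \<longleftrightarrow> hol_open \<Omega> U"
  by (simp add: hol_topology_def istopology_hol_open)

lemma topspace_hol_topology [simp]: "topspace (hol_topology \<Omega>) = hol_space \<Omega>"
proof
  show "topspace (hol_topology \<Omega>) \<subseteq> hol_space \<Omega>"
    by (rule hol_open_subset) (simp flip: openin_hol_topology)
  have "hol_open \<Omega> (hol_space \<Omega>)"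
    unfolding hol_open_def
    by (intro conjI ballI subset_refl exI[of _ "{}"] exI[of _ "1::real"]) simp_all
  then show "hol_space \<Omega> \<subseteq> topspace (hol_topology \<Omega>)"
    by (simp add: openin_hol_topology openin_subset)
qed

text \<open>
  A power series \<open>\<Sum>\<^sub>v a\<^sub>v (z - \<zeta>)\<^sup>v\<close> is given as the formal power series of its coefficients, and
  a rational function is an element of the fraction field of the polynomials, in the local
  variable \<open>w = z - \<zeta>\<close>. The quotient of formal power series below is the Taylor series of \<open>P/Q\<close>
  because \<open>Q\<close> has constant coefficient 1.
\<close>

definition is_pade :: "nat \<Rightarrow> nat \<Rightarrow> complex fps \<Rightarrow> complex poly fract \<Rightarrow> bool" where
  "is_pade p q a R \<longleftrightarrow>
     (\<exists>P Q. degree P \<le> p \<and> degree Q \<le> q \<and> coeff Q 0 = 1 \<and> R = Fract P Q \<and>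
        (\<forall>v\<le>p + q. fps_nth (fps_of_poly P / fps_of_poly Q) v = fps_nth a v))"

definition pade :: "nat \<Rightarrow> nat \<Rightarrow> complex fps \<Rightarrow> complex poly fract" where
  "pade p q a = (THE R. is_pade p q a R)"

text \<open>
  \<^const>\<open>quot_of_fract\<close> yields numerator and denominator in lowest terms, so the denominator
  vanishes exactly at the poles.
\<close>

definition rat_value :: "complex poly fract \<Rightarrow> complex \<Rightarrow> complex option" where
  "rat_value R w =
     (let (P, Q) = quot_of_fract R in if poly Q w = 0 then None else Some (poly P w / poly Q w))"

definition pade_value ::
  "nat \<Rightarrow> nat \<Rightarrow> (complex \<Rightarrow> complex) \<Rightarrow> complex \<Rightarrow> complex \<Rightarrow> complex option" where
  "pade_value p q f \<zeta> z = rat_value (pade p q (fps_expansion f \<zeta>)) (z - \<zeta>)"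

fun sphere_error :: "complex option \<Rightarrow> complex \<Rightarrow> ennreal" where
  "sphere_error None c = \<infinity>"
| "sphere_error (Some b) c = ennreal (norm (b - c))"

definition int_coeff :: "complex fps \<Rightarrow> int \<Rightarrow> complex" where
  "int_coeff a k = (if k < 0 then 0 else fps_nth a (nat k))"

text \<open>
  Matrix indices start at 0 here, so the entry \<open>a\<^bsub>p-q+i+j-1\<^esub>\<close> with \<open>1 \<le> i, j \<le> q\<close> becomes
  \<open>a\<^bsub>p-q+i+j+1\<^esub>\<close> with \<open>0 \<le> i, j < q\<close>. The empty determinant is 1.
\<close>

definition pade_hankel :: "nat \<Rightarrow> nat \<Rightarrow> complex fps \<Rightarrow> complex Matrix.mat" where
  "pade_hankel p q a =
     Matrix.mat q q (\<lambda>(i, j). int_coeff a (int p - int q + int i + int j + 1))"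

definition pade_normal :: "nat \<Rightarrow> nat \<Rightarrow> complex \<Rightarrow> (complex \<Rightarrow> complex) set" where
  "pade_normal p q \<zeta> = {f. Determinant.det (pade_hankel p q (fps_expansion f \<zeta>)) \<noteq> 0}"

definition pade_approximable ::
  "complex set \<Rightarrow> (nat \<times> nat) set \<Rightarrow> (complex \<Rightarrow> complex) set" where
  "pade_approximable \<Omega> \<F> =
     {f \<in> hol_space \<Omega>. \<exists>p q :: nat \<Rightarrow> nat. (\<forall>n. (p n, q n) \<in> \<F>) \<and>
        (\<forall>K. compact K \<and> K \<subseteq> \<Omega> \<longrightarrow>
           (\<exists>N. \<forall>n\<ge>N. \<forall>\<zeta>\<in>K. f \<in> pade_normal (p n) (q n) \<zeta>) \<and>
           (\<lambda>n. SUP \<zeta>\<in>K. SUP z\<in>K. sphere_error (pade_value (p n) (q n) f \<zeta> z) (f z))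
             \<longlonglongrightarrow> 0)}"

end

theory Submission
  imports Defs
begin

text \<open>
  A polynomial \<open>G\<close> of degree exactly \<open>p\<close> has the antitriangular Hankel matrix with \<open>lead_coeff G\<close> on
  the antidiagonal at every centre, and it is its own Pade approximant \<open>[p/q]\<close> for every \<open>q\<close>. By
  Runge's theorem such polynomials with \<open>(p, q) \<in> \<F>\<close> are dense in \<open>H(\<Omega>)\<close>, since \<open>p\<close> may be taken
  arbitrarily large and a small multiple of \<open>z\<^sup>p\<close> may be added. The functions whose approximant
  \<open>[p/q]\<close> is good on a fixed compact set form an open set, because by Jacobi's determinant formula
  the approximant depends continuously on finitely many Taylor coefficients, and these depend
  continuously on the function and on the centre. The functions in question form a countable
  intersection of unions of such sets, and Baire's argument applies.

  Runge's theorem is obtained from the Cauchy integral formula on a square grid: \<open>\<Omega>\<close> is exhausted by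
  compact sets with connected complement, so that all poles of the Riemann sums can be pushed to
  infinity.
\<close>

subsection \<open>Polynomial approximation on compact sets\<close>

text \<open>Two points govern the shape of the proof. The value of a Pade approximant is read off
  lowest terms, and cancellation is not continuous in the coefficients. A nonzero Hankel determinant
  rules cancellation out: the pair given by Cramer's rule then has no common factor of positive
  degree, so a single formula gives both values and poles and passes to limits. Moreover the centre
  runs through the compact set together with the argument, so a compact family of approximants has
  to be controlled at once; openness is therefore proved by following bad centres and arguments
  along a sequence to a limit in \<open>K \<times> K\<close>. One sequence of indices must serve
  every compact set. It suffices to choose one pair for each set of an exhaustion, because a compact
  set lies in all but finitely many of them. Since \<Omega> may be disconnected, simple
  connectedness enters through the complement: a bounded component of the complement of an
  exhausting set would cut off part of the sphere minus \<Omega> from infinity.\<close>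

definition poly_approximable :: "complex set \<Rightarrow> (complex \<Rightarrow> complex) \<Rightarrow> bool" where
  "poly_approximable K g \<longleftrightarrow> (\<forall>\<epsilon>>0. \<exists>p. \<forall>z\<in>K. norm (g z - poly p z) < \<epsilon>)"

lemma poly_approximable_poly: "poly_approximable K (poly p)"
  unfolding poly_approximable_def by (intro allI impI exI[of _ p]) simp

lemma poly_approximable_const: "poly_approximable K (\<lambda>z. c)"
  unfolding poly_approximable_def by (intro allI impI exI[of _ "[:c:]"]) simp

lemma poly_approximable_ident: "poly_approximable K (\<lambda>z. z)"
  unfolding poly_approximable_def by (intro allI impI exI[of _ "[:0, 1:]"]) simp

lemma poly_approximable_cong:
  "poly_approximable K g \<Longrightarrow> (\<And>z. z \<in> K \<Longrightarrow> g z = h z) \<Longrightarrow> poly_approximable K h"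
  by (simp add: poly_approximable_def)

lemma poly_approximable_limit:
  assumes "\<And>\<epsilon>. \<epsilon> > 0 \<Longrightarrow> \<exists>h. poly_approximable K h \<and> (\<forall>z\<in>K. norm (g z - h z) < \<epsilon>)"
  shows "poly_approximable K g"
  unfolding poly_approximable_def
proof (intro allI impI)
  fix \<epsilon> :: real assume "\<epsilon> > 0"
  obtain h where h: "poly_approximable K h" "\<And>z. z \<in> K \<Longrightarrow> norm (g z - h z) < \<epsilon> / 2"
    using assms[of "\<epsilon> / 2"] \<open>\<epsilon> > 0\<close> by auto
  obtain p where p: "\<And>z. z \<in> K \<Longrightarrow> norm (h z - poly p z) < \<epsilon> / 2"
    using h(1) \<open>\<epsilon> > 0\<close> unfolding poly_approximable_def by (meson half_gt_zero)
  have "norm (g z - poly p z) < \<epsilon>" if "z \<in> K" for z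
    using norm_triangle_lt[of "g z - h z" "h z - poly p z" \<epsilon>] h(2)[OF that] p[OF that] by simp
  then show "\<exists>p. \<forall>z\<in>K. norm (g z - poly p z) < \<epsilon>" by blast
qed

lemma poly_approximable_add:
  assumes "poly_approximable K g" "poly_approximable K h"
  shows "poly_approximable K (\<lambda>z. g z + h z)"
  unfolding poly_approximable_def
proof (intro allI impI)
  fix \<epsilon> :: real assume "\<epsilon> > 0"
  obtain p where p: "\<And>z. z \<in> K \<Longrightarrow> norm (g z - poly p z) < \<epsilon> / 2"
    using assms(1) \<open>\<epsilon> > 0\<close> unfolding poly_approximable_def by (meson half_gt_zero)
  obtain q where q: "\<And>z. z \<in> K \<Longrightarrow> norm (h z - poly q z) < \<epsilon> / 2"
    using assms(2) \<open>\<epsilon> > 0\<close> unfolding poly_approximable_def by (meson half_gt_zero)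
  have "norm (g z + h z - poly (p + q) z) < \<epsilon>" if "z \<in> K" for z
    using norm_triangle_lt[of "g z - poly p z" "h z - poly q z" \<epsilon>] p[OF that] q[OF that]
    by (simp add: algebra_simps)
  then show "\<exists>p. \<forall>z\<in>K. norm (g z + h z - poly p z) < \<epsilon>" by blast
qed

lemma poly_approximable_sum:
  "(\<And>i. i \<in> I \<Longrightarrow> poly_approximable K (g i)) \<Longrightarrow> poly_approximable K (\<lambda>z. \<Sum>i\<in>I. g i z)"
  by (induction I rule: infinite_finite_induct)
    (simp_all add: poly_approximable_const poly_approximable_add)

lemma poly_approximable_bounded:
  assumes "poly_approximable K g" "compact K"
  shows "\<exists>B>0. \<forall>z\<in>K. norm (g z) \<le> B"
proof -
  obtain p where p: "\<And>z. z \<in> K \<Longrightarrow> norm (g z - poly p z) < 1"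
    using assms(1)[unfolded poly_approximable_def, rule_format, of 1] by auto
  have "bounded (poly p ` K)"
    using assms(2) by (intro compact_imp_bounded compact_continuous_image continuous_intros)
  then obtain B where B: "B > 0" "\<And>z. z \<in> K \<Longrightarrow> norm (poly p z) \<le> B"
    unfolding bounded_pos by auto
  have "norm (g z) \<le> 1 + B" if "z \<in> K" for z
    using norm_triangle_ineq[of "g z - poly p z" "poly p z"] p[OF that] B(2)[OF that] by simp
  with B(1) show ?thesis by (intro exI[of _ "1 + B"]) auto
qed

lemma poly_approximable_mult:
  assumes g: "poly_approximable K g" and h: "poly_approximable K h" and K: "compact K"
  shows "poly_approximable K (\<lambda>z. g z * h z)"
  unfolding poly_approximable_def
proof (intro allI impI)
  fix \<epsilon> :: real assume "\<epsilon> > 0"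
  obtain B where B: "B > 0" "\<And>z. z \<in> K \<Longrightarrow> norm (g z) \<le> B"
    using poly_approximable_bounded[OF g K] by blast
  obtain q where q: "\<And>z. z \<in> K \<Longrightarrow> norm (h z - poly q z) < \<epsilon> / (2 * B)"
    using h \<open>\<epsilon> > 0\<close> \<open>B > 0\<close> unfolding poly_approximable_def
    by (meson divide_pos_pos mult_pos_pos zero_less_numeral)
  \<comment> \<open>\<open>q\<close> is fixed first so that \<open>C\<close> can bound it; the
    accuracy asked of \<open>p\<close> then depends on \<open>C\<close>.\<close>
  obtain C where C: "C > 0" "\<And>z. z \<in> K \<Longrightarrow> norm (poly q z) \<le> C"
    using poly_approximable_bounded[OF poly_approximable_poly K] by blast
  obtain p where p: "\<And>z. z \<in> K \<Longrightarrow> norm (g z - poly p z) < \<epsilon> / (2 * C)"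
    using g \<open>\<epsilon> > 0\<close> \<open>C > 0\<close> unfolding poly_approximable_def
    by (meson divide_pos_pos mult_pos_pos zero_less_numeral)
  have "norm (g z * h z - poly (p * q) z) < \<epsilon>" if z: "z \<in> K" for z
  proof -
    have "g z * h z - poly (p * q) z = g z * (h z - poly q z) + (g z - poly p z) * poly q z"
      by (simp add: algebra_simps)
    also have "norm \<dots> \<le> norm (g z) * norm (h z - poly q z) + norm (g z - poly p z) * norm (poly q z)"
      by (metis norm_mult norm_triangle_ineq)
    also have "\<dots> \<le> B * norm (h z - poly q z) + norm (g z - poly p z) * C"
      using B(1) B(2)[OF z] C(2)[OF z] by (intro add_mono mult_mono) auto
    also have "\<dots> < B * (\<epsilon> / (2 * B)) + \<epsilon> / (2 * C) * C"
      using p[OF z] q[OF z] B(1) C(1) by (intro add_strict_mono mult_strict_left_mono mult_strict_right_mono) auto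
    also have "\<dots> = \<epsilon>" using B(1) C(1) by (simp add: field_simps)
    finally show ?thesis .
  qed
  then show "\<exists>p. \<forall>z\<in>K. norm (g z * h z - poly p z) < \<epsilon>" by blast
qed

lemma poly_approximable_power:
  "poly_approximable K g \<Longrightarrow> compact K \<Longrightarrow> poly_approximable K (\<lambda>z. g z ^ n)"
  by (induction n) (simp_all add: poly_approximable_const poly_approximable_mult)

section \<open>Pushing the poles of Cauchy kernels to infinity\<close>

lemma poly_approximable_geometric:
  assumes h: "poly_approximable K h" and K: "compact K" and small: "\<And>z. z \<in> K \<Longrightarrow> norm (h z) \<le> 1/2"
  shows "poly_approximable K (\<lambda>z. 1 / (1 - h z))"
proof (rule poly_approximable_limit)
  fix \<epsilon> :: real assume "\<epsilon> > 0"
  \<comment> \<open>The tail of the series is \<open>h z ^ n / (1 - h z)\<close>; its denominator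
    has norm at least 1/2, which doubles the bound \<open>(1/2) ^ n\<close>.\<close>
  obtain n where n: "(1/2) ^ n < \<epsilon> / 2"
    using real_arch_pow_inv[of "\<epsilon> / 2" "1/2"] \<open>\<epsilon> > 0\<close> by auto
  have "norm (1 / (1 - h z) - (\<Sum>i<n. h z ^ i)) < \<epsilon>" if z: "z \<in> K" for z
  proof -
    have 1: "norm (1 - h z) \<ge> 1/2"
      using norm_triangle_ineq2[of 1 "h z"] small[OF z] by simp
    then have "h z \<noteq> 1" by auto
    then have "(\<Sum>i<n. h z ^ i) = (1 - h z ^ n) / (1 - h z)"
      by (simp add: sum_gp_strict)
    with \<open>h z \<noteq> 1\<close> have "1 / (1 - h z) - (\<Sum>i<n. h z ^ i) = h z ^ n / (1 - h z)"
      by (simp add: field_simps)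
    also have "norm \<dots> = norm (h z) ^ n / norm (1 - h z)" by (simp add: norm_divide norm_power)
    also have "\<dots> \<le> (1/2) ^ n / (1/2)"
      using 1 small[OF z] by (intro frac_le power_mono) auto
    finally show ?thesis using n by simp
  qed
  moreover have "poly_approximable K (\<lambda>z. \<Sum>i<n. h z ^ i)"
    by (intro poly_approximable_sum poly_approximable_power h K)
  ultimately show "\<exists>k. poly_approximable K k \<and> (\<forall>z\<in>K. norm (1 / (1 - h z) - k z) < \<epsilon>)" by blast
qed

text \<open>Since \<open>1 - (v - w) / (v - z) = (w - z) / (v - z)\<close>, the kernel at
  \<open>w\<close> is the kernel at \<open>v\<close> times a geometric series whose ratio has norm
  at most 1/2 on \<open>K\<close>.\<close>

lemma poly_approximable_move_pole:
  assumes K: "compact K" and v: "poly_approximable K (\<lambda>z. 1 / (v - z))"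
    and far: "\<And>z. z \<in> K \<Longrightarrow> norm (v - w) \<le> norm (v - z) / 2 \<and> z \<noteq> v \<and> z \<noteq> w"
  shows "poly_approximable K (\<lambda>z. 1 / (w - z))"
proof -
  let ?h = "\<lambda>z. (v - w) * (1 / (v - z))"
  have "poly_approximable K ?h"
    by (intro poly_approximable_mult v K poly_approximable_const)
  moreover have "norm (?h z) \<le> 1/2" if "z \<in> K" for z

  proof -
    have "norm (v - z) > 0" using far[OF that] by auto
    then show ?thesis using far[OF that] by (simp add: norm_divide pos_divide_le_eq)
  qed
  ultimately have "poly_approximable K (\<lambda>z. 1 / (1 - ?h z))"
    by (intro poly_approximable_geometric K)
  then have "poly_approximable K (\<lambda>z. (1 / (v - z)) * (1 / (1 - ?h z)))"
    by (intro poly_approximable_mult v K)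
  then show ?thesis
  proof (rule poly_approximable_cong)
    fix z assume "z \<in> K"
    with far have "v - z \<noteq> 0" "w - z \<noteq> 0" by auto
    then show "(1 / (v - z)) * (1 / (1 - ?h z)) = 1 / (w - z)"
      by (simp add: divide_simps)
  qed
qed

text \<open>Approximability of the kernel survives small moves of the pole, so on the connected
  complement of \<open>K\<close> it spreads from one pole far out to all others.\<close>

lemma poly_approximable_pole:
  assumes K: "compact K" and conn: "connected (- K)" and w: "w \<notin> K"
  shows "poly_approximable K (\<lambda>z. 1 / (w - z))"
proof -
  obtain B where B: "B > 0" "\<And>z. z \<in> K \<Longrightarrow> norm z \<le> B"
    using compact_imp_bounded[OF K] unfolding bounded_pos by auto
  \<comment> \<open>At this pole \<open>z / ?a\<close> has norm at most 1/2 on \<open>K\<close>, so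
    the kernel is a geometric series in \<open>z\<close>.\<close>
  let ?a = "complex_of_real (2 * B)"
  have a: "poly_approximable K (\<lambda>z. 1 / (?a - z))"
  proof (rule poly_approximable_cong)
    have small: "norm ((1 / ?a) * z) \<le> 1/2" if "z \<in> K" for z
      using B(1) B(2)[OF that] by (simp add: norm_divide pos_divide_le_eq)
    have "poly_approximable K (\<lambda>z. (1 / ?a) * z)"
      by (rule poly_approximable_mult[OF poly_approximable_const poly_approximable_ident K])
    from poly_approximable_mult[OF poly_approximable_const
        poly_approximable_geometric[OF this K small] K]
    show "poly_approximable K (\<lambda>z. (1 / ?a) * (1 / (1 - (1 / ?a) * z)))" .
    fix z assume "z \<in> K"
    with B(1) B(2)[of z] have "norm z < norm ?a" by simp
    then have "?a \<noteq> z" by auto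
    then have "?a - z \<noteq> 0" "?a \<noteq> 0" using B(1) by simp_all
    moreover have "(1 / a) * (1 / (1 - (1 / a) * z)) = 1 / (a - z)" if "a \<noteq> 0" "a - z \<noteq> 0" for a
      using that by (simp add: divide_simps)
    ultimately show "(1 / ?a) * (1 / (1 - (1 / ?a) * z)) = 1 / (?a - z)" by blast
  qed
  show ?thesis
  proof (rule connected_induction_simple[OF conn, of ?a w "\<lambda>w. poly_approximable K (\<lambda>z. 1 / (w - z))"])
    show "?a \<in> - K"
    proof
      assume "?a \<in> K"
      then have "norm ?a \<le> B" by (rule B(2))
      with B(1) show False by simp
    qed
  next
    fix a assume "a \<in> - K"
    then obtain e where e: "e > 0" "ball a e \<subseteq> - K"
      using compact_imp_closed[OF K] by (meson open_Compl open_contains_ball)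
    \<comment> \<open>Two points of \<open>?T\<close> are less than \<open>e / 3\<close> apart and
      more than \<open>5 * e / 6\<close> away from \<open>K\<close>. Half of the latter exceeds the
      former, so the pole can move between them in either direction.\<close>
    let ?T = "ball a (e / 6)"
    have "?T \<subseteq> - K" using e subset_ball[of "e / 6" e a] by auto
    then have "openin (top_of_set (- K)) ?T" by (intro open_subset) auto
    moreover have "a \<in> ?T" using e(1) by simp
    moreover have "poly_approximable K (\<lambda>z. 1 / (y - z))"
      if xy: "x \<in> ?T" "y \<in> ?T" and x: "poly_approximable K (\<lambda>z. 1 / (x - z))" for x y
    proof (rule poly_approximable_move_pole[OF K x])
      fix z assume "z \<in> K"
      with e(2) have "dist a z \<ge> e" by (auto simp: subset_iff not_less)
      moreover have "dist a x < e / 6" "dist a y < e / 6"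
        using xy by auto
      moreover have "dist x y \<le> dist a x + dist a y" "dist a z \<le> dist a x + dist x z"
          "dist a z \<le> dist a y + dist y z"
        by (rule dist_triangle3 dist_triangle)+
      ultimately have "dist x y \<le> dist x z / 2" "dist x z > 0" "dist y z > 0"
        using e(1) by linarith+
      then show "norm (x - y) \<le> norm (x - z) / 2 \<and> z \<noteq> x \<and> z \<noteq> y"
        unfolding dist_norm by (metis diff_self norm_zero less_irrefl)
    qed
    ultimately show "\<exists>T. openin (top_of_set (- K)) T \<and> a \<in> T \<and>
        (\<forall>x\<in>T. \<forall>y\<in>T. poly_approximable K (\<lambda>z. 1 / (x - z)) \<longrightarrow> poly_approximable K (\<lambda>z. 1 / (y - z)))"
      by blast
  next
    show "w \<in> - K" using w by simp
    show "poly_approximable K (\<lambda>z. 1 / (?a - z))" by (rule a)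
  qed
qed

text \<open>The integrand is uniformly continuous on the segment times \<open>K\<close>, so Riemann
  sums converge uniformly in \<open>z\<close>. Each term is a constant times a kernel with pole on
  the segment, hence off \<open>K\<close>.\<close>

lemma poly_approximable_segment_integral:
  assumes K: "compact K" and conn: "connected (- K)" and disj: "closed_segment a b \<inter> K = {}"
    and f: "continuous_on (closed_segment a b) f"
  shows "poly_approximable K (\<lambda>z. contour_integral (linepath a b) (\<lambda>w. f w / (w - z)))"
proof (rule poly_approximable_limit)
  fix \<epsilon> :: real assume "\<epsilon> > 0"
  define k where "k = (\<lambda>(w, z). f w / (w - z))"
  have "continuous_on (closed_segment a b \<times> K) k"
    unfolding k_def case_prod_beta
    by (intro continuous_intros continuous_on_compose2[OF f]) (use disj in auto)
  then have unif: "uniformly_continuous_on (closed_segment a b \<times> K) k"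
    by (intro compact_uniformly_continuous compact_Times K compact_segment)
  \<comment> \<open>The \<open>+ 1\<close> covers the degenerate segment with
    \<open>a = b\<close>.\<close>
  define \<eta> where "\<eta> = \<epsilon> / (norm (b - a) + 1)"
  have \<eta>: "\<eta> > 0" "\<eta> * norm (b - a) < \<epsilon>"
    using \<open>\<epsilon> > 0\<close> by (auto simp: \<eta>_def add_pos_nonneg add_nonneg_pos divide_simps algebra_simps)
  obtain \<delta> where \<delta>: "\<delta> > 0"
    "\<And>x y. x \<in> closed_segment a b \<times> K \<Longrightarrow> y \<in> closed_segment a b \<times> K \<Longrightarrow> dist x y < \<delta> \<Longrightarrow> dist (k x) (k y) < \<eta>"
    using unif \<eta>(1) unfolding uniformly_continuous_on_def by metis
  obtain N :: nat where N: "norm (b - a) / \<delta> < real N"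
    using reals_Archimedean2 by blast
  moreover have "norm (b - a) / \<delta> \<ge> 0" using \<delta>(1) by simp
  ultimately have "N > 0" by (cases N) auto
  define c where "c i = a + of_real (real i / real N) * (b - a)" for i :: nat
  have c_seg: "c i \<in> closed_segment a b" if "i \<le> N" for i
  proof -
    have "a + of_real t * (b - a) = (1 - t) *\<^sub>R a + t *\<^sub>R b" for t
      by (simp add: scaleR_conv_of_real algebra_simps)
    then show ?thesis
      using that \<open>N > 0\<close> unfolding c_def closed_segment_def by fastforce
  qed
  have c_step: "c (Suc i) - c i = (b - a) / of_nat N" for i
    using \<open>N > 0\<close> by (simp add: c_def field_simps)
  \<comment> \<open>The integral is split by induction from the left end, which needs the node
    \<open>c i\<close> on the segment from \<open>a\<close> to the next node.\<close>
  have c_in: "c i \<in> closed_segment a (c (Suc i))" for i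
  proof -
    have gen: "a + of_real r * (b - a) = (1 - s) *\<^sub>R a + s *\<^sub>R (a + of_real t * (b - a))"
      if "s * t = r" for r s t
      unfolding scaleR_conv_of_real that[symmetric] by (simp add: algebra_simps)
    have "c i = (1 - real i / real (Suc i)) *\<^sub>R a + (real i / real (Suc i)) *\<^sub>R c (Suc i)"
      unfolding c_def by (rule gen) (simp del: of_nat_Suc)
    then show ?thesis
      unfolding closed_segment_def by (auto intro!: exI[of _ "real i / real (Suc i)"])
  qed
  have cN: "c 0 = a" "c N = b" using \<open>N > 0\<close> by (auto simp: c_def)
  define h where "h z = (\<Sum>i<N. (f (c i) * (c (Suc i) - c i)) * (1 / (c i - z)))" for z
  have "poly_approximable K h"
    unfolding h_def
    by (intro poly_approximable_sum poly_approximable_mult[OF poly_approximable_const _ K]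
        poly_approximable_pole K conn) (use c_seg disj in \<open>auto simp: disjoint_iff\<close>)
  moreover have "norm (contour_integral (linepath a b) (\<lambda>w. f w / (w - z)) - h z) < \<epsilon>" if z: "z \<in> K" for z
  proof -
    let ?g = "\<lambda>w. f w / (w - z)"
    have g: "continuous_on (closed_segment a b) ?g"
      by (intro continuous_intros f) (use z disj in auto)
    have sub: "closed_segment (c i) (c j) \<subseteq> closed_segment a b" if "i \<le> N" "j \<le> N" for i j
      using c_seg[OF that(1)] c_seg[OF that(2)] by (simp add: subset_closed_segment)
    have g': "continuous_on (closed_segment (c i) (c j)) ?g" if "i \<le> N" "j \<le> N" for i j
      by (rule continuous_on_subset[OF g sub[OF that]])
    have split: "contour_integral (linepath a (c n)) ?g = (\<Sum>i<n. contour_integral (linepath (c i) (c (Suc i))) ?g)"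
      if "n \<le> N" for n
      using that
    proof (induction n)
      case 0
      show ?case by (simp only: cN contour_integral_trivial lessThan_0 sum.empty)
    next
      case (Suc n)
      then show ?case
        using contour_integral_split_linepath[OF _ c_in[of n], of ?g] g'[of 0 "Suc n"] by (simp add: cN)
    qed
    have piece: "norm (contour_integral (linepath (c i) (c (Suc i))) ?g - (f (c i) * (c (Suc i) - c i)) * (1 / (c i - z)))
        \<le> \<eta> * norm (b - a) / N" if i: "i < N" for i
    proof -
      have int: "(\<lambda>w. ?g w - ?g (c i)) contour_integrable_on (linepath (c i) (c (Suc i)))"
        using i by (intro contour_integrable_continuous_linepath continuous_on_diff continuous_on_const g') auto
      have "contour_integral (linepath (c i) (c (Suc i))) ?g - (f (c i) * (c (Suc i) - c i)) * (1 / (c i - z))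
          = contour_integral (linepath (c i) (c (Suc i))) (\<lambda>w. ?g w - ?g (c i))"
        using g'[of i "Suc i"] i
        by (subst contour_integral_diff) (auto intro: contour_integrable_continuous_linepath)
      also have "norm \<dots> \<le> \<eta> * norm (c (Suc i) - c i)"
      proof (rule contour_integral_bound_linepath[OF int])
        fix w assume w: "w \<in> closed_segment (c i) (c (Suc i))"
        have "dist (w, z) (c i, z) = norm (w - c i)" by (simp add: dist_Pair_Pair dist_norm)
        also have "\<dots> \<le> norm (c (Suc i) - c i)"
          using segment_bound1[OF w] by simp
        also have "\<dots> = norm (b - a) / N" by (simp add: c_step norm_divide)
        also have "\<dots> < \<delta>" using N \<delta>(1) \<open>N > 0\<close> by (simp add: field_simps)
        finally have "dist (k (w, z)) (k (c i, z)) < \<eta>"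
          using w z sub[of i "Suc i"] i c_seg[of i] by (intro \<delta>(2)) auto
        then show "norm (?g w - ?g (c i)) \<le> \<eta>" by (simp add: k_def dist_norm)
      qed (use \<eta> in auto)
      finally show ?thesis by (simp add: c_step norm_divide)
    qed
    have "norm (contour_integral (linepath a b) ?g - h z)
        = norm (\<Sum>i<N. contour_integral (linepath (c i) (c (Suc i))) ?g - (f (c i) * (c (Suc i) - c i)) * (1 / (c i - z)))"
      unfolding h_def sum_subtractf using split[of N] by (simp add: cN)
    also have "\<dots> \<le> (\<Sum>i<N. \<eta> * norm (b - a) / N)"
      by (intro sum_norm_le piece) auto
    also have "\<dots> = \<eta> * norm (b - a)" using \<open>N > 0\<close> by simp
    finally show ?thesis using \<eta>(2) by simp
  qed
  ultimately show "\<exists>h. poly_approximable K h \<and>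
      (\<forall>z\<in>K. norm (contour_integral (linepath a b) (\<lambda>w. f w / (w - z)) - h z) < \<epsilon>)" by blast
qed

subsection \<open>Cauchy's formula on a square grid\<close>

definition corner :: "real \<Rightarrow> int \<Rightarrow> int \<Rightarrow> complex" where
  "corner h i j = Complex (h * i) (h * j)"

definition hedge :: "real \<Rightarrow> (complex \<Rightarrow> complex) \<Rightarrow> int \<times> int \<Rightarrow> complex" where
  "hedge h g = (\<lambda>(i, j). contour_integral (linepath (corner h i j) (corner h (i + 1) j)) g)"

definition vedge :: "real \<Rightarrow> (complex \<Rightarrow> complex) \<Rightarrow> int \<times> int \<Rightarrow> complex" where
  "vedge h g = (\<lambda>(i, j). contour_integral (linepath (corner h i j) (corner h i (j + 1))) g)"

definition grid_square :: "real \<Rightarrow> int \<times> int \<Rightarrow> complex set" where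
  "grid_square h = (\<lambda>(i, j). cbox (corner h i j) (corner h (i + 1) (j + 1)))"

definition grid_lines :: "real \<Rightarrow> complex set" where
  "grid_lines h = (\<Union>k::int. {z. Re z = h * k} \<union> {z. Im z = h * k})"

text \<open>The two squares lie above and below the edge. If just one of them meets
  \<open>K\<close>, the edge also lies in the other one and so avoids \<open>K\<close>.\<close>

lemma hedge_subset_grid_square:
  assumes "h > 0"
  shows "closed_segment (corner h i j) (corner h (i + 1) j) \<subseteq> grid_square h (i, j)"
    and "closed_segment (corner h i j) (corner h (i + 1) j) \<subseteq> grid_square h (i, j - 1)"
  unfolding grid_square_def prod.case using assms
  by (intro closed_segment_subset convex_box;
      simp add: corner_def in_cbox_complex_iff algebra_simps)+

lemma vedge_subset_grid_square:
  assumes "h > 0"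
  shows "closed_segment (corner h i j) (corner h i (j + 1)) \<subseteq> grid_square h (i, j)"
    and "closed_segment (corner h i j) (corner h i (j + 1)) \<subseteq> grid_square h (i - 1, j)"
  unfolding grid_square_def prod.case using assms
  by (intro closed_segment_subset convex_box;
      simp add: corner_def in_cbox_complex_iff algebra_simps)+

lemma edges_subset_grid_lines:
  "closed_segment (corner h i j) (corner h (i + 1) j) \<subseteq> grid_lines h"
  "closed_segment (corner h i j) (corner h i (j + 1)) \<subseteq> grid_lines h"
proof -
  have "Im z = h * j" if "z \<in> closed_segment (corner h i j) (corner h (i + 1) j)" for z
    using that by (subst (asm) closed_segment_same_Im) (auto simp: corner_def)
  then show "closed_segment (corner h i j) (corner h (i + 1) j) \<subseteq> grid_lines h"
    unfolding grid_lines_def by blast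
  have "Re z = h * i" if "z \<in> closed_segment (corner h i j) (corner h i (j + 1))" for z
    using that by (subst (asm) closed_segment_same_Re) (auto simp: corner_def)
  then show "closed_segment (corner h i j) (corner h i (j + 1)) \<subseteq> grid_lines h"
    unfolding grid_lines_def by blast
qed

text \<open>The left side runs once counterclockwise around the square, the top and left edges being
  taken against their direction. Off the grid lines \<open>z\<close> is never on the boundary, so
  either Cauchy's formula or Cauchy's theorem applies.\<close>

lemma Cauchy_grid_square:
  assumes h: "h > 0" and f: "f holomorphic_on grid_square h (i, j)" and z: "z \<notin> grid_lines h"
  defines "g \<equiv> \<lambda>w. f w / (w - z)"
  shows "hedge h g (i, j) + vedge h g (i + 1, j) - hedge h g (i, j + 1) - vedge h g (i, j)
    = (if z \<in> grid_square h (i, j) then 2 * pi * \<i> * f z else 0)"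
proof -
  let ?a = "corner h i j" and ?b = "corner h (i + 1) j" and ?c = "corner h (i + 1) (j + 1)"
    and ?d = "corner h i (j + 1)"
  let ?S = "grid_square h (i, j)"
  have S: "?S = cbox ?a ?c" by (simp add: grid_square_def)
  have seg: "closed_segment ?a ?b \<subseteq> ?S - {z}" "closed_segment ?b ?c \<subseteq> ?S - {z}"
    "closed_segment ?d ?c \<subseteq> ?S - {z}" "closed_segment ?a ?d \<subseteq> ?S - {z}"
    using hedge_subset_grid_square(1)[OF h, of i j] hedge_subset_grid_square(2)[OF h, of i "j + 1"]
      vedge_subset_grid_square(1)[OF h, of i j] vedge_subset_grid_square(2)[OF h, of "i + 1" j]
      edges_subset_grid_lines(1)[of h i j] edges_subset_grid_lines(1)[of h i "j + 1"]
      edges_subset_grid_lines(2)[of h i j] edges_subset_grid_lines(2)[of h "i + 1" j] z by auto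
  have cont: "continuous_on (?S - {z}) g"
    unfolding g_def
    by (intro continuous_intros continuous_on_subset[OF holomorphic_on_imp_continuous_on[OF f]]) auto
  have c: "continuous_on (closed_segment ?a ?b) g" "continuous_on (closed_segment ?b ?c) g"
    "continuous_on (closed_segment ?d ?c) g" "continuous_on (closed_segment ?a ?d) g"
    by (rule continuous_on_subset[OF cont] seg)+
  have c': "continuous_on (closed_segment ?c ?d) g" "continuous_on (closed_segment ?d ?a) g"
    using c by (simp_all add: closed_segment_commute)
  have rect: "rectpath ?a ?c = linepath ?a ?b +++ linepath ?b ?c +++ linepath ?c ?d +++ linepath ?d ?a"
    by (simp add: rectpath_def Let_def corner_def)
  have "contour_integral (rectpath ?a ?c) g = contour_integral (linepath ?a ?b) g
      + (contour_integral (linepath ?b ?c) g + (contour_integral (linepath ?c ?d) g + contour_integral (linepath ?d ?a) g))"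
    unfolding rect using c c'
    by (simp add: contour_integrable_continuous_linepath contour_integrable_joinI)
  also have "\<dots> = hedge h g (i, j) + vedge h g (i + 1, j) - hedge h g (i, j + 1) - vedge h g (i, j)"
    using contour_integral_reverse_linepath[OF c'(1)] contour_integral_reverse_linepath[OF c'(2)]
    by (simp add: hedge_def vedge_def)
  finally have eq: "contour_integral (rectpath ?a ?c) g = \<dots>" .
  have le: "Re ?a \<le> Re ?c" "Im ?a \<le> Im ?c" using h by (auto simp: corner_def)
  have path: "path_image (rectpath ?a ?c) \<subseteq> ?S - {z}"
    unfolding rect using seg by (auto simp: path_image_join closed_segment_commute)
  have "contour_integral (rectpath ?a ?c) g = (if z \<in> ?S then 2 * pi * \<i> * f z else 0)"
  proof (cases "z \<in> ?S")
    case True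
    with path_image_rectpath_cbox_minus_box[OF le] path have "z \<in> box ?a ?c"
      using z h unfolding S by (auto simp: in_cbox_complex_iff in_box_complex_iff corner_def grid_lines_def order.strict_iff_order)
    then have "winding_number (rectpath ?a ?c) z = 1" "z \<in> interior ?S"
      by (simp_all add: winding_number_rectpath S interior_cbox)
    with Cauchy_integral_formula_convex_simple[OF _ f _ _ path] True
    show ?thesis unfolding g_def by (intro contour_integral_unique) (simp add: S)
  next
    case False
    have "g holomorphic_on ?S"
      unfolding g_def using False by (intro holomorphic_intros f) auto
    then have "(g has_contour_integral 0) (rectpath ?a ?c)"
      using path by (intro Cauchy_theorem_convex_simple[of g ?S]) (auto simp: S)
    with False show ?thesis by (simp add: contour_integral_unique)
  qed
  with eq show ?thesis by simp
qed

text \<open>Off the grid lines the closed squares agree with half-open ones, and those partition the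
  plane.\<close>

lemma grid_square_unique:
  assumes "h > 0" "z \<notin> grid_lines h"
  shows "z \<in> grid_square h s \<longleftrightarrow> s = (\<lfloor>Re z / h\<rfloor>, \<lfloor>Im z / h\<rfloor>)"
proof -
  obtain i j where s: "s = (i, j)" by fastforce
  have ne: "Re z \<noteq> h * k" "Im z \<noteq> h * k" for k :: int
    using assms(2) unfolding grid_lines_def by auto
  have "z \<in> grid_square h (i, j) \<longleftrightarrow> h * i \<le> Re z \<and> Re z \<le> h * (i + 1) \<and> h * j \<le> Im z \<and> Im z \<le> h * (j + 1)"
    by (auto simp: grid_square_def in_cbox_complex_iff corner_def)
  also have "\<dots> \<longleftrightarrow> h * i \<le> Re z \<and> Re z < h * (i + 1) \<and> h * j \<le> Im z \<and> Im z < h * (j + 1)"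
    using ne(1)[of "i + 1"] ne(2)[of "j + 1"] by (auto simp: order.strict_iff_order)
  also have "\<dots> \<longleftrightarrow> i = \<lfloor>Re z / h\<rfloor> \<and> j = \<lfloor>Im z / h\<rfloor>"
    using assms(1) by (auto simp: floor_eq_iff eq_commute[of i] eq_commute[of j] field_simps)
  finally show ?thesis by (simp add: s)
qed

text \<open>Measure zero stands in for empty interior: an open set contained in the grid lines must
  be empty.\<close>

lemma negligible_grid_lines: "negligible (grid_lines h)"
proof -
  have "{z. Re z = c} = {z. 1 \<bullet> z = c}" "{z. Im z = c} = {z. \<i> \<bullet> z = c}" for c
    by (auto simp: inner_complex_def)
  then have "negligible {z. Re z = c}" "negligible {z. Im z = c}" for c
    by (simp_all only: negligible_hyperplane one_neq_zero complex_i_not_zero simp_thms not_False_eq_True)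
  then show ?thesis
    unfolding grid_lines_def by (intro negligible_countable_Union) (auto intro: negligible_Un)
qed

text \<open>Cauchy's formula is summed over the squares that meet \<open>K\<close>. An edge shared
  by two of them cancels; an edge of only one of them avoids \<open>K\<close>, so its integral can
  be approximated by polynomials.\<close>

lemma poly_approximable_off_grid:
  assumes \<Omega>: "open \<Omega>" and f: "f holomorphic_on \<Omega>" and K: "compact K" "K \<subseteq> \<Omega>"
    and conn: "connected (- K)"
  shows "\<exists>h F. poly_approximable K F \<and> (\<forall>z\<in>K - grid_lines h. F z = f z)"
proof -
  obtain d where d: "d > 0" "(\<Union>x\<in>K. ball x d) \<subseteq> \<Omega>"
    using compact_subset_open_imp_ball_epsilon_subset[OF K(1) \<Omega> K(2)] by blast
  \<comment> \<open>Points of one square differ by at most \<open>h\<close> in each coordinate,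
    hence by at most \<open>d / 2\<close> in norm, so a square that meets \<open>K\<close> stays
    inside \<Omega>.\<close>
  define h where "h = d / 4"
  have h: "h > 0" using d(1) by (simp add: h_def)
  define S where "S = {s. grid_square h s \<inter> K \<noteq> {}}"
  have sub: "grid_square h s \<subseteq> \<Omega>" if S: "s \<in> S" for s
  proof
    fix w assume w: "w \<in> grid_square h s"
    obtain i j where s: "s = (i, j)" by fastforce
    obtain z where z: "z \<in> K" "z \<in> grid_square h s" using S unfolding S_def by blast
    have "\<bar>Re (z - w)\<bar> \<le> h" "\<bar>Im (z - w)\<bar> \<le> h"
      using w z(2) by (auto simp: s grid_square_def in_cbox_complex_iff corner_def algebra_simps)
    then have "dist z w < d"
      using cmod_le[of "z - w"] d(1) by (simp add: dist_norm h_def)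
    with z(1) d(2) show "w \<in> \<Omega>" by (meson UN_I mem_ball subsetD)
  qed
  have "finite S"
  proof -
    obtain B where B: "\<And>z. z \<in> K \<Longrightarrow> norm z \<le> B"
      using compact_imp_bounded[OF K(1)] unfolding bounded_iff by auto
    define N where "N = \<lceil>B / h\<rceil> + 1"
    have N: "B / h + 1 \<le> N" unfolding N_def by linarith
    have bound: "- N \<le> k \<and> k \<le> N" if "h * k \<le> x" "x \<le> h * (k + 1)" "\<bar>x\<bar> \<le> B" for k :: int and x
    proof -
      have "real_of_int k \<le> B / h" "- (B / h) \<le> k + 1"
        using that h by (auto simp: field_simps)
      with N show ?thesis by linarith
    qed
    have "S \<subseteq> {-N..N} \<times> {-N..N}"
    proof
      fix s assume "s \<in> S"
      obtain i j where s: "s = (i, j)" by fastforce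
      obtain z where z: "z \<in> K" "z \<in> grid_square h s" using \<open>s \<in> S\<close> unfolding S_def by blast
      from B[OF z(1)] have "\<bar>Re z\<bar> \<le> B" "\<bar>Im z\<bar> \<le> B"
        using abs_Re_le_cmod[of z] abs_Im_le_cmod[of z] by linarith+
      with z(2) bound[of i "Re z"] bound[of j "Im z"] show "s \<in> {-N..N} \<times> {-N..N}"
        by (auto simp: s grid_square_def in_cbox_complex_iff corner_def)
    qed
    then show ?thesis by (rule finite_subset) simp
  qed
  \<comment> \<open>\<open>U\<close> and \<open>R\<close> index the upper and right edges of the
    squares in \<open>S\<close> by their starting corners, while \<open>S\<close> indexes the lower
    and left edges. Lower and right edges count positively, upper and left ones negatively; the
    terms that survive cancellation are the set differences in \<open>F\<close>.\<close>
  define U where "U = (\<lambda>(i, j). (i, j + 1)) ` S"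
  define R where "R = (\<lambda>(i, j). (i + 1, j)) ` S"
  have fin: "finite U" "finite R" using \<open>finite S\<close> by (auto simp: U_def R_def)
  let ?g = "\<lambda>z w. f w / (w - z)"
  define F where "F z = (1 / (2 * pi * \<i>)) * ((\<Sum>s\<in>S - U. hedge h (?g z) s) + (\<Sum>s\<in>U - S. (-1) * hedge h (?g z) s)
      + (\<Sum>s\<in>R - S. vedge h (?g z) s) + (\<Sum>s\<in>S - R. (-1) * vedge h (?g z) s))" for z
  have seg: "poly_approximable K (\<lambda>z. contour_integral (linepath a b) (?g z))"
    if "closed_segment a b \<subseteq> grid_square h s" "closed_segment a b \<subseteq> grid_square h s'" "s \<in> S" "s' \<notin> S" for a b s s'
    using that sub[of s]
    by (intro poly_approximable_segment_integral K conn continuous_on_subset[OF holomorphic_on_imp_continuous_on[OF f]])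
      (auto simp: S_def)
  have hseg: "poly_approximable K (\<lambda>z. hedge h (?g z) s)" if "s \<in> (S - U) \<union> (U - S)" for s
  proof -
    obtain i j where s: "s = (i, j)" by fastforce
    \<comment> \<open>Membership in \<open>U\<close> means that the square below the edge is in
      \<open>S\<close>; in the symmetric difference of \<open>S\<close> and \<open>U\<close>,
      exactly one adjacent square meets \<open>K\<close>.\<close>
    have "(i, j) \<in> U \<longleftrightarrow> (i, j - 1) \<in> S" by (force simp: U_def)
    with that seg[OF hedge_subset_grid_square[OF h]] seg[OF hedge_subset_grid_square(2,1)[OF h]]
    show ?thesis unfolding s hedge_def prod.case by blast
  qed
  have vseg: "poly_approximable K (\<lambda>z. vedge h (?g z) s)" if "s \<in> (S - R) \<union> (R - S)" for s
  proof -
    obtain i j where s: "s = (i, j)" by fastforce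
    have "(i, j) \<in> R \<longleftrightarrow> (i - 1, j) \<in> S" by (force simp: R_def)
    with that seg[OF vedge_subset_grid_square[OF h]] seg[OF vedge_subset_grid_square(2,1)[OF h]]
    show ?thesis unfolding s vedge_def prod.case by blast
  qed
  have "poly_approximable K F"
    unfolding F_def
    by (intro poly_approximable_mult[OF poly_approximable_const _ K(1)] poly_approximable_add
        poly_approximable_sum hseg vseg) auto
  moreover have "F z = f z" if z: "z \<in> K - grid_lines h" for z
  proof -
    let ?s = "(\<lfloor>Re z / h\<rfloor>, \<lfloor>Im z / h\<rfloor>)"
    have z': "z \<in> grid_square h s \<longleftrightarrow> s = ?s" for s
      using grid_square_unique[OF h] z by blast
    then have "?s \<in> S" using z unfolding S_def by blast
    have cancel: "(\<Sum>s\<in>A. c s) - (\<Sum>s\<in>B. c s) = (\<Sum>s\<in>A - B. c s) + (\<Sum>s\<in>B - A. (-1) * c s)"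
      if "finite A" "finite B" for A B :: "(int \<times> int) set" and c :: "int \<times> int \<Rightarrow> complex"
      using that sum.Int_Diff[of A c B] sum.Int_Diff[of B c A]
      by (simp add: Int_commute sum_negf)
    have U: "(\<Sum>s\<in>U. hedge h (?g z) s) = (\<Sum>(i, j)\<in>S. hedge h (?g z) (i, j + 1))"
      unfolding U_def by (subst sum.reindex) (auto simp: inj_on_def case_prod_beta)
    have R: "(\<Sum>s\<in>R. vedge h (?g z) s) = (\<Sum>(i, j)\<in>S. vedge h (?g z) (i + 1, j))"
      unfolding R_def by (subst sum.reindex) (auto simp: inj_on_def case_prod_beta)
    have "2 * pi * \<i> * F z = ((\<Sum>s\<in>S. hedge h (?g z) s) - (\<Sum>s\<in>U. hedge h (?g z) s))
        + ((\<Sum>s\<in>R. vedge h (?g z) s) - (\<Sum>s\<in>S. vedge h (?g z) s))"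
      unfolding F_def using \<open>finite S\<close> fin by (simp only: cancel) simp
    also have "\<dots> = (\<Sum>(i, j)\<in>S. hedge h (?g z) (i, j) + vedge h (?g z) (i + 1, j)
        - hedge h (?g z) (i, j + 1) - vedge h (?g z) (i, j))"
      unfolding U R by (simp add: case_prod_beta sum.distrib sum_subtractf)
    also have "\<dots> = (\<Sum>s\<in>S. if z \<in> grid_square h s then 2 * pi * \<i> * f z else 0)"
    proof (rule sum.cong)
      fix s assume "s \<in> S"
      obtain i j where s: "s = (i, j)" by fastforce
      have "f holomorphic_on grid_square h (i, j)"
        using holomorphic_on_subset[OF f] sub \<open>s \<in> S\<close> s by blast
      then show "(case s of (i, j) \<Rightarrow> hedge h (?g z) (i, j) + vedge h (?g z) (i + 1, j)
          - hedge h (?g z) (i, j + 1) - vedge h (?g z) (i, j))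
          = (if z \<in> grid_square h s then 2 * pi * \<i> * f z else 0)"
        unfolding s prod.case using z by (intro Cauchy_grid_square[OF h]) auto
    qed simp
    also have "\<dots> = 2 * pi * \<i> * f z"
      unfolding z' using \<open>?s \<in> S\<close> \<open>finite S\<close> by (simp add: sum.delta)
    finally show ?thesis by simp
  qed
  ultimately show ?thesis by blast
qed

text \<open>Only on the grid lines is the approximation still open. In the interior of
  \<open>K\<close> the set where the error exceeds \<epsilon>/2 is an open set contained in the grid
  lines, hence empty.\<close>

lemma Runge_compact:
  assumes "open \<Omega>" "f holomorphic_on \<Omega>" "compact K" "K \<subseteq> \<Omega>" "connected (- K)"
  shows "poly_approximable (interior K) f"
  unfolding poly_approximable_def
proof (intro allI impI)
  fix \<epsilon> :: real assume "\<epsilon> > 0"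
  obtain h F where F: "poly_approximable K F" "\<And>z. z \<in> K - grid_lines h \<Longrightarrow> F z = f z"
    using poly_approximable_off_grid[OF assms] by blast
  obtain p where p: "\<And>z. z \<in> K \<Longrightarrow> norm (F z - poly p z) < \<epsilon> / 2"
    using F(1) \<open>\<epsilon> > 0\<close> unfolding poly_approximable_def by (meson half_gt_zero)
  let ?W = "{z \<in> interior K. norm (f z - poly p z) > \<epsilon> / 2}"
  have "continuous_on (interior K) (\<lambda>z. norm (f z - poly p z))"
    using assms(4) interior_subset[of K]
    by (intro continuous_intros continuous_on_subset[OF holomorphic_on_imp_continuous_on[OF assms(2)]]) auto
  then have "open (interior K \<inter> (\<lambda>z. norm (f z - poly p z)) -` {\<epsilon> / 2 <..})"
    by (intro continuous_open_preimage) auto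
  moreover have "interior K \<inter> (\<lambda>z. norm (f z - poly p z)) -` {\<epsilon> / 2 <..} = ?W" by auto
  ultimately have "open ?W" by simp
  moreover have "?W \<subseteq> grid_lines h"
    using p F(2) interior_subset[of K] by force
  then have "negligible ?W" using negligible_grid_lines negligible_subset by blast
  ultimately have "?W = {}" using open_not_negligible by blast
  then have "norm (f z - poly p z) < \<epsilon>" if "z \<in> interior K" for z
    using that \<open>\<epsilon> > 0\<close> by fastforce
  then show "\<exists>p. \<forall>z\<in>interior K. norm (f z - poly p z) < \<epsilon>" by blast
qed

subsection \<open>Runge's theorem\<close>

text \<open>The distance condition is imposed point by point rather than with
  \<open>infdist\<close>, which is 0 for the empty set: when \<Omega> is the whole plane it holds
  vacuously.\<close>

definition exhaustion :: "complex set \<Rightarrow> nat \<Rightarrow> complex set" where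
  "exhaustion \<Omega> n = {z. norm z \<le> n \<and> (\<forall>a\<in>- \<Omega>. dist z a \<ge> 1 / Suc n)}"

lemma exhaustion_subset: "exhaustion \<Omega> n \<subseteq> \<Omega>"
proof
  fix z assume "z \<in> exhaustion \<Omega> n"
  then have "z \<in> - \<Omega> \<Longrightarrow> dist z z \<ge> 1 / Suc n" unfolding exhaustion_def by blast
  moreover have "\<not> dist z z \<ge> 1 / Suc n" by (simp add: not_le)
  ultimately show "z \<in> \<Omega>" by blast
qed

lemma Compl_exhaustion: "- exhaustion \<Omega> n = - cball 0 n \<union> (\<Union>a\<in>- \<Omega>. ball a (1 / Suc n))"
  unfolding exhaustion_def set_eq_iff
  by (simp add: dist_commute not_le del: of_nat_Suc)

lemma compact_exhaustion: "compact (exhaustion \<Omega> n)"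
proof -
  have "open (- exhaustion \<Omega> n)"
    unfolding Compl_exhaustion by (intro open_Un open_UN ballI open_ball open_Compl closed_cball)
  then have "closed (exhaustion \<Omega> n)" by (simp add: closed_def)
  moreover have "bounded (exhaustion \<Omega> n)"
    by (rule boundedI[of _ "real n"]) (simp add: exhaustion_def)
  ultimately show ?thesis by (simp add: compact_eq_bounded_closed)
qed

lemma exhaustion_mono: "m \<le> n \<Longrightarrow> exhaustion \<Omega> m \<subseteq> exhaustion \<Omega> n"
proof
  fix z assume mn: "m \<le> n" and z: "z \<in> exhaustion \<Omega> m"
  have "1 / real (Suc n) \<le> 1 / real (Suc m)" using mn by (simp add: frac_le)
  with z mn show "z \<in> exhaustion \<Omega> n" unfolding exhaustion_def by (auto intro: order_trans)
qed

lemma compact_subset_interior_exhaustion: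
  assumes "open \<Omega>" "compact K" "K \<subseteq> \<Omega>"
  shows "\<exists>n. K \<subseteq> interior (exhaustion \<Omega> n)"
proof -
  obtain d where d: "d > 0" "(\<Union>x\<in>K. ball x d) \<subseteq> \<Omega>"
    using compact_subset_open_imp_ball_epsilon_subset[OF assms(2,1,3)] by blast
  obtain B where B: "\<And>z. z \<in> K \<Longrightarrow> norm z \<le> B"
    using compact_imp_bounded[OF assms(2)] unfolding bounded_iff by auto
  obtain n :: nat where n: "max (B + 1) (2 / d) < n" using reals_Archimedean2 by blast
  then have n': "B + 1 < n" "1 / Suc n < d / 2" using d(1) by (auto simp: field_simps)
  have "ball x (min 1 (d / 2)) \<subseteq> exhaustion \<Omega> n" if x: "x \<in> K" for x
  proof
    fix z assume "z \<in> ball x (min 1 (d / 2))"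
    then have z: "dist x z < 1" "dist x z < d / 2" by auto
    have "norm z \<le> n"
      using B[OF x] z(1) n'(1) norm_triangle_ineq3[of z x] by (simp add: dist_norm norm_minus_commute)
    moreover have "dist z a \<ge> 1 / Suc n" if a: "a \<in> - \<Omega>" for a
    proof -
      have "dist x a \<ge> d" using d(2) x a by (fastforce simp: not_less)
      with z(2) n'(2) dist_triangle[of x a z] show ?thesis by linarith
    qed
    ultimately show "z \<in> exhaustion \<Omega> n" by (simp add: exhaustion_def)
  qed
  moreover have "x \<in> ball x (min 1 (d / 2))" for x using d(1) by simp
  ultimately have "K \<subseteq> interior (exhaustion \<Omega> n)"
    by (meson interiorI open_ball subsetI)
  then show ?thesis by blast
qed

text \<open>A component \<open>?C\<close> that misses the exterior of the disc would be bounded, yet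
  contain the centre of a ball around some point outside \<Omega>. The part of \<open>?C\<close>
  outside \<Omega> would then be separated from infinity on the sphere.\<close>

lemma connected_Compl_exhaustion:
  assumes \<Omega>: "open \<Omega>" "sphere_simply_connected \<Omega>"
  shows "connected (- exhaustion \<Omega> n)"
proof -
  let ?S = "- exhaustion \<Omega> n" and ?V = "- cball (0::complex) n"
  have opS: "open ?S" using compact_exhaustion compact_imp_closed by blast
  have V: "connected ?V" by (intro connected_complement_bounded_convex) auto
  have VS: "?V \<subseteq> ?S" unfolding Compl_exhaustion by blast
  have meet: "connected_component_set ?S z \<inter> ?V \<noteq> {}" if z: "z \<in> ?S" for z
  proof
    let ?C = "connected_component_set ?S z"
    assume empty: "?C \<inter> ?V = {}"
    moreover have "z \<in> ?C" using z by simp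
    ultimately have "z \<notin> ?V" by blast
    with z obtain a where a: "a \<in> - \<Omega>" "z \<in> ball a (1 / Suc n)"
      unfolding Compl_exhaustion by blast
    have "ball a (1 / Suc n) \<subseteq> ?S" unfolding Compl_exhaustion using a(1) by blast
    then have "ball a (1 / Suc n) \<subseteq> ?C"
      using a(2) by (intro connected_component_maximal) auto
    then have aC: "a \<in> ?C" by (auto simp: subset_iff)
    define X where "X = ?C - \<Omega>"
    obtain T where T: "closed T" "?C = ?S \<inter> T"
      using closedin_connected_component[of ?S z] unfolding closedin_closed by blast
    \<comment> \<open>The complement of \<Omega> lies in \<open>?S\<close>, so \<open>X\<close> is
      closed in the plane although \<open>?C\<close> is only closed in \<open>?S\<close>.\<close>
    have "X = T \<inter> - \<Omega>"
      unfolding X_def T(2) using exhaustion_subset[of \<Omega> n] by blast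
    then have "closed X" using T(1) \<Omega>(1) by (simp add: closed_Int closed_Compl)
    moreover have "bounded X"
      using empty by (intro bounded_subset[OF bounded_cball[of 0 "real n"]]) (auto simp: X_def)
    ultimately have "compact X" by (simp add: compact_eq_bounded_closed)
    let ?A = "Alexandroff_compactification (euclidean :: complex topology)"
    \<comment> \<open>The two open sets of the sphere cover the complement of \<Omega> and overlap
      only inside \<Omega>.\<close>
    have 1: "openin ?A (Some ` ?C)"
      using opS by (simp add: open_connected_component)
    have 2: "openin ?A (insert None (Some ` (UNIV - X)))"
      unfolding openin_Alexandroff_compactification using \<open>compact X\<close> \<open>closed X\<close> by auto
    show False
    proof (rule connectedinD[OF \<Omega>(2)[unfolded sphere_simply_connected_def] 1 2])
      show "UNIV - Some ` \<Omega> \<subseteq> Some ` ?C \<union> insert None (Some ` (UNIV - X))"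
      proof
        fix y :: "complex option" assume "y \<in> UNIV - Some ` \<Omega>"
        then show "y \<in> Some ` ?C \<union> insert None (Some ` (UNIV - X))"
          unfolding X_def by (cases y) blast+
      qed
      show "Some ` ?C \<inter> insert None (Some ` (UNIV - X)) \<inter> (UNIV - Some ` \<Omega>) = {}"
        unfolding X_def by blast
      show "Some ` ?C \<inter> (UNIV - Some ` \<Omega>) \<noteq> {}" using aC a(1) by blast
      show "insert None (Some ` (UNIV - X)) \<inter> (UNIV - Some ` \<Omega>) \<noteq> {}" by blast
    qed
  qed
  show ?thesis
    unfolding connected_iff_connected_component
  proof (intro ballI)
    fix x y assume "x \<in> ?S" "y \<in> ?S"
    then obtain x' y' where *: "x' \<in> ?V" "connected_component ?S x x'" "y' \<in> ?V" "connected_component ?S y y'"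
      using meet[of x] meet[of y] by blast
    have "connected_component ?S x' y'"
      using V VS *(1,3) unfolding connected_component_def by blast
    with * show "connected_component ?S x y"
      by (meson connected_component_sym connected_component_trans)
  qed
qed

lemma Runge_sphere_simply_connected:
  assumes "open \<Omega>" "sphere_simply_connected \<Omega>" "f holomorphic_on \<Omega>" "compact K" "K \<subseteq> \<Omega>"
  shows "poly_approximable K f"
proof -
  obtain n where n: "K \<subseteq> interior (exhaustion \<Omega> n)"
    using compact_subset_interior_exhaustion[OF assms(1,4,5)] by blast
  have "poly_approximable (interior (exhaustion \<Omega> n)) f"
    by (rule Runge_compact[OF assms(1,3) compact_exhaustion exhaustion_subset
          connected_Compl_exhaustion[OF assms(1,2)]])
  with n show ?thesis unfolding poly_approximable_def by (meson subsetD)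
qed

text \<open>The exact degree is what makes the Hankel antidiagonal nonzero. A multiple of the power
  of order \<open>p\<close>, scaled by its bound on \<open>K\<close>, enforces it at the cost of
  \<epsilon>/2.\<close>

lemma Runge_large_degree:
  assumes f: "poly_approximable K f" and K: "compact K" and "\<epsilon> > 0"
  shows "\<exists>N. \<forall>p\<ge>N. \<exists>G. G \<noteq> 0 \<and> degree G = p \<and> (\<forall>z\<in>K. dist (poly G z) (f z) < \<epsilon>)"
proof -
  obtain P where P: "\<And>z. z \<in> K \<Longrightarrow> norm (f z - poly P z) < \<epsilon> / 2"
    using f \<open>\<epsilon> > 0\<close> unfolding poly_approximable_def by (meson half_gt_zero)
  have "\<exists>G. G \<noteq> 0 \<and> degree G = p \<and> (\<forall>z\<in>K. dist (poly G z) (f z) < \<epsilon>)" if p: "p \<ge> Suc (degree P)" for p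
  proof -
    obtain B where B: "B > 0" "\<And>z. z \<in> K \<Longrightarrow> norm (poly (monom 1 p) z) \<le> B"
      using poly_approximable_bounded[OF poly_approximable_poly K] by blast
    define c where "c = complex_of_real (\<epsilon> / (2 * B))"
    have c: "c \<noteq> 0" "norm c = \<epsilon> / (2 * B)" using B(1) \<open>\<epsilon> > 0\<close> by (simp_all add: c_def norm_divide norm_mult)
    let ?G = "P + monom c p"
    have deg: "degree ?G = p"
      using p c(1) by (subst degree_add_eq_right) (simp_all add: degree_monom_eq)
    moreover have "?G \<noteq> 0" using deg p by auto
    moreover have "dist (poly ?G z) (f z) < \<epsilon>" if z: "z \<in> K" for z
    proof -
      have "norm (poly (monom c p) z) = norm c * norm (poly (monom 1 p) z)"
        by (simp add: poly_monom norm_mult)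
      also have "\<dots> \<le> norm c * B" using B(2)[OF z] by (intro mult_left_mono) auto
      also have "\<dots> = \<epsilon> / 2" using B(1) by (simp add: c(2))
      finally show ?thesis
        using P[OF z] norm_triangle_ineq4[of "poly (monom c p) z" "f z - poly P z"]
        by (simp add: dist_norm algebra_simps)
    qed
    ultimately show ?thesis by blast
  qed
  then show ?thesis by blast
qed

subsection \<open>Algebra of Pade approximants\<close>

lemma fps_mult_cong_upto:
  assumes "\<And>v. v \<le> N \<Longrightarrow> fps_nth f v = fps_nth g v" "v \<le> N"
  shows "fps_nth (f * h) v = fps_nth (g * h) v"
  unfolding fps_mult_nth using assms by (intro sum.cong) auto

text \<open>The order condition with the denominator cleared, hence linear in the coefficients of
  \<open>P\<close> and \<open>Q\<close>. Nothing is lost, because \<open>Q\<close> is invertible as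
  a power series.\<close>

definition pade_pair :: "nat \<Rightarrow> nat \<Rightarrow> complex fps \<Rightarrow> complex poly \<Rightarrow> complex poly \<Rightarrow> bool" where
  "pade_pair p q a P Q \<longleftrightarrow> degree P \<le> p \<and> degree Q \<le> q \<and> coeff Q 0 = 1 \<and>
     (\<forall>v\<le>p + q. coeff P v = fps_nth (a * fps_of_poly Q) v)"

lemma is_pade_iff_pade_pair: "is_pade p q a R \<longleftrightarrow> (\<exists>P Q. pade_pair p q a P Q \<and> R = Fract P Q)"
proof -
  have "(\<forall>v\<le>p + q. fps_nth (fps_of_poly P / fps_of_poly Q) v = fps_nth a v) \<longleftrightarrow>
      (\<forall>v\<le>p + q. coeff P v = fps_nth (a * fps_of_poly Q) v)" if "coeff Q 0 = 1" for P Q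
  proof -
    let ?P = "fps_of_poly P" and ?Q = "fps_of_poly Q"
    have Q: "fps_nth ?Q 0 \<noteq> 0" using that by simp
    then have PQ: "?P / ?Q = ?P * inverse ?Q" by (rule fps_divide_unit)
    have inv: "?Q * inverse ?Q = 1" using Q by (simp add: inverse_mult_eq_1')
    then have "?P / ?Q * ?Q = ?P" unfolding PQ by (simp add: mult.assoc mult.commute[of "inverse ?Q"])
    with fps_mult_cong_upto[of "p + q" "?P / ?Q" a _ ?Q]
    have 1: "coeff P v = fps_nth (a * ?Q) v"
      if "\<And>v. v \<le> p + q \<Longrightarrow> fps_nth (?P / ?Q) v = fps_nth a v" "v \<le> p + q" for v
      using that by (metis fps_of_poly_nth)
    have "a * ?Q * inverse ?Q = a" using inv by (simp add: mult.assoc)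
    with fps_mult_cong_upto[of "p + q" ?P "a * ?Q" _ "inverse ?Q"]
    have 2: "fps_nth (?P / ?Q) v = fps_nth a v"
      if "\<And>v. v \<le> p + q \<Longrightarrow> fps_nth ?P v = fps_nth (a * ?Q) v" "v \<le> p + q" for v
      using that unfolding PQ by simp
    show ?thesis using 1 2 by auto
  qed
  then show ?thesis unfolding is_pade_def pade_pair_def by metis
qed

text \<open>Both products agree with \<open>a * Q * Q'\<close> up to order \<open>p + q\<close>, and
  neither has larger degree.\<close>

lemma pade_pair_cross:
  assumes PQ: "pade_pair p q a P Q" and PQ': "pade_pair p q a P' Q'"
  shows "P * Q' = P' * Q"
proof (rule poly_eqI)
  fix v
  show "coeff (P * Q') v = coeff (P' * Q) v"
  proof (cases "v \<le> p + q")
    case True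
    have "fps_nth (fps_of_poly P * fps_of_poly Q') v = fps_nth (a * fps_of_poly Q * fps_of_poly Q') v"
      using PQ True by (intro fps_mult_cong_upto[of "p + q"]) (auto simp: pade_pair_def)
    also have "\<dots> = fps_nth (a * fps_of_poly Q' * fps_of_poly Q) v" by (simp add: mult_ac)
    also have "\<dots> = fps_nth (fps_of_poly P' * fps_of_poly Q) v"
      using PQ' True by (intro fps_mult_cong_upto[of "p + q", symmetric]) (auto simp: pade_pair_def)
    finally show ?thesis by (simp flip: fps_of_poly_mult)
  next
    case False
    have "degree (P * Q') \<le> p + q" "degree (P' * Q) \<le> p + q"
      using PQ PQ' degree_mult_le[of P Q'] degree_mult_le[of P' Q] unfolding pade_pair_def by linarith+
    with False show ?thesis by (simp add: coeff_eq_0)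
  qed
qed

lemma pade_eq_Fract:
  assumes "pade_pair p q a P Q"
  shows "pade p q a = Fract P Q"
  unfolding pade_def
proof (rule the_equality)
  show "is_pade p q a (Fract P Q)" using assms is_pade_iff_pade_pair by blast
  fix R assume "is_pade p q a R"
  then obtain P' Q' where "pade_pair p q a P' Q'" "R = Fract P' Q'" using is_pade_iff_pade_pair by blast
  moreover from this assms have "Q \<noteq> 0" "Q' \<noteq> 0" unfolding pade_pair_def by auto
  ultimately show "R = Fract P Q" using pade_pair_cross[OF assms] by (simp add: eq_fract)
qed

lemma fps_nth_mult_poly:
  assumes "degree Q \<le> q"
  shows "fps_nth (a * fps_of_poly Q) v = (\<Sum>k\<le>q. coeff Q k * int_coeff a (int v - int k))"
proof -
  have "fps_nth (a * fps_of_poly Q) v = (\<Sum>k=0..v. coeff Q k * fps_nth a (v - k))"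
    by (subst mult.commute) (simp add: fps_mult_nth)
  \<comment> \<open>Beyond \<open>v\<close> the factor \<open>int_coeff\<close> is zero and beyond
    \<open>q\<close> the factor \<open>coeff Q\<close> is, so this common range covers both
    sums.\<close>
  also have "\<dots> = (\<Sum>k\<in>{..max q v}. coeff Q k * int_coeff a (int v - int k))"
    by (intro sum.mono_neutral_cong_left) (auto simp: int_coeff_def nat_diff_distrib)
  also have "\<dots> = (\<Sum>k\<le>q. coeff Q k * int_coeff a (int v - int k))"
    using assms by (intro sum.mono_neutral_right) (auto simp: coeff_eq_0)
  finally show ?thesis .
qed

lemma pade_hankel_carrier: "pade_hankel p q a \<in> carrier_mat q q"
  by (simp add: pade_hankel_def)

text \<open>With \<open>k = q - j\<close> the entry index becomes \<open>p + 1 + i - k\<close>: row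
  \<open>i\<close> is the convolution sum of order \<open>p + 1 + i\<close> without its term
  \<open>k = 0\<close>.\<close>

lemma pade_hankel_mult_vec:
  assumes "i < q"
  shows "vec_index (pade_hankel p q a *\<^sub>v Matrix.vec q (\<lambda>j. c (q - j))) i
    = (\<Sum>k=1..q. c k * int_coeff a (int (p + 1 + i) - int k))"
proof -
  have "vec_index (pade_hankel p q a *\<^sub>v Matrix.vec q (\<lambda>j. c (q - j))) i
      = (\<Sum>j=0..<q. int_coeff a (int p - int q + int i + int j + 1) * c (q - j))"
    using assms by (simp add: pade_hankel_def scalar_prod_def)
  also have "\<dots> = (\<Sum>k=1..q. c k * int_coeff a (int (p + 1 + i) - int k))"
    by (rule sum.reindex_bij_witness[of _ "\<lambda>k. q - k" "\<lambda>j. q - j"])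
      (auto simp: of_nat_diff algebra_simps)
  finally show ?thesis .
qed

text \<open>
  The entries of \<open>Matrix.vec q (\<lambda>j. coeff Q (q - j))\<close> are the unknowns of the Hankel system, in reverse order.
\<close>

lemma pade_equations_iff:
  assumes "degree Q \<le> q"
  shows "(\<forall>v. p < v \<and> v \<le> p + q \<longrightarrow> fps_nth (a * fps_of_poly Q) v = 0) \<longleftrightarrow>
    pade_hankel p q a *\<^sub>v Matrix.vec q (\<lambda>j. coeff Q (q - j)) = Matrix.vec q (\<lambda>i. - (coeff Q 0 * int_coeff a (int (p + 1 + i))))"
proof -
  have "fps_nth (a * fps_of_poly Q) (p + 1 + i) = coeff Q 0 * int_coeff a (int (p + 1 + i))
      + vec_index (pade_hankel p q a *\<^sub>v Matrix.vec q (\<lambda>j. coeff Q (q - j))) i" if "i < q" for i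
    unfolding fps_nth_mult_poly[OF assms] pade_hankel_mult_vec[OF that]
    by (simp add: atMost_atLeast0 sum.atLeast_Suc_atMost)
  then have "fps_nth (a * fps_of_poly Q) (p + 1 + i) = 0 \<longleftrightarrow>
      vec_index (pade_hankel p q a *\<^sub>v Matrix.vec q (\<lambda>j. coeff Q (q - j))) i = - (coeff Q 0 * int_coeff a (int (p + 1 + i)))"
    if "i < q" for i
    using that by (simp add: eq_neg_iff_add_eq_0 add.commute)
  moreover have "(\<forall>v. p < v \<and> v \<le> p + q \<longrightarrow> fps_nth (a * fps_of_poly Q) v = 0) \<longleftrightarrow>
      (\<forall>i<q. fps_nth (a * fps_of_poly Q) (p + 1 + i) = 0)"
  proof (intro iffI allI impI)
    fix v assume *: "\<forall>i<q. fps_nth (a * fps_of_poly Q) (p + 1 + i) = 0" and v: "p < v \<and> v \<le> p + q"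
    then have "v - p - 1 < q" "p + 1 + (v - p - 1) = v" by auto
    with * show "fps_nth (a * fps_of_poly Q) v = 0" by metis
  qed auto
  ultimately show ?thesis
    by (auto simp: Matrix.vec_eq_iff pade_hankel_def)
qed

text \<open>Equality of fractions leaves a common factor undetermined. The determinant fixes the
  denominator itself, whose coefficients of positive order solve an invertible linear
  system.\<close>

lemma pade_pair_unique:
  assumes det: "Determinant.det (pade_hankel p q a) \<noteq> 0"
    and PQ: "pade_pair p q a P Q" and PQ': "pade_pair p q a P' Q'"
  shows "Q = Q'"
proof -
  let ?H = "pade_hankel p q a"
  let ?x = "\<lambda>Q. Matrix.vec q (\<lambda>j. coeff Q (q - j))"
  have eq: "?H *\<^sub>v ?x Q = Matrix.vec q (\<lambda>i. - int_coeff a (int (p + 1 + i)))"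
    if "pade_pair p q a P Q" for P Q
  proof -
    have "fps_nth (a * fps_of_poly Q) v = 0" if "p < v \<and> v \<le> p + q" for v
    proof -
      have "fps_nth (a * fps_of_poly Q) v = coeff P v" using \<open>pade_pair p q a P Q\<close> that by (simp add: pade_pair_def)
      also have "\<dots> = 0" using \<open>pade_pair p q a P Q\<close> that by (intro coeff_eq_0) (auto simp: pade_pair_def)
      finally show ?thesis .
    qed
    with that pade_equations_iff[of Q q p a] show ?thesis by (simp add: pade_pair_def)
  qed
  have "?H *\<^sub>v (?x Q - ?x Q') = ?H *\<^sub>v ?x Q - ?H *\<^sub>v ?x Q'"
    by (rule mult_minus_distrib_mat_vec[OF pade_hankel_carrier]) auto
  also have "\<dots> = 0\<^sub>v q" unfolding eq[OF PQ] eq[OF PQ'] by simp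
  finally have "?H *\<^sub>v (?x Q - ?x Q') = 0\<^sub>v q" .
  moreover have "?x Q - ?x Q' \<in> carrier_vec q" by simp
  ultimately have "?x Q - ?x Q' = 0\<^sub>v q"
    using det det_0_iff_vec_prod_zero_field[OF pade_hankel_carrier, of p q a] by blast
  then have *: "coeff Q (q - j) = coeff Q' (q - j)" if "j < q" for j
    using that by (auto simp: Matrix.vec_eq_iff)
  show ?thesis
  proof (rule poly_eqI)
    fix k
    consider "k = 0" | "0 < k" "k \<le> q" | "k > q" by linarith
    then show "coeff Q k = coeff Q' k"
    proof cases
      case 2
      then show ?thesis using *[of "q - k"] by simp
    qed (use PQ PQ' in \<open>auto simp: pade_pair_def coeff_eq_0\<close>)
  qed
qed

text \<open>If \<open>g\<close> had positive degree, it could be replaced by any \<open>r\<close> of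
  degree at most 1 with constant coefficient 1 within the same degree bounds. The choices 1 and 1 +
  w yield different denominators, against uniqueness.\<close>

lemma pade_pair_reduced:
  assumes det: "Determinant.det (pade_hankel p q a) \<noteq> 0" and PQ: "pade_pair p q a P Q"
    and g: "P = P0 * g" "Q = Q0 * g"
  shows "degree g = 0"
proof (rule ccontr)
  assume deg: "degree g \<noteq> 0"
  have "Q \<noteq> 0" using PQ by (auto simp: pade_pair_def)
  then have "g \<noteq> 0" "Q0 \<noteq> 0" using g by auto
  have "coeff Q 0 = coeff Q0 0 * coeff g 0" unfolding g by (simp add: coeff_mult)
  then have nz: "coeff Q0 0 \<noteq> 0" "coeff g 0 \<noteq> 0" using PQ by (auto simp: pade_pair_def)
  \<comment> \<open>Cancelling \<open>g\<close> may spoil the normalisation; \<open>c\<close>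
    restores the constant coefficient 1.\<close>
  define c where "c = 1 / coeff Q0 0"
  have agree: "fps_nth (fps_of_poly P0) v = fps_nth (a * fps_of_poly Q0) v" if "v \<le> p + q" for v
  proof -
    have inv: "fps_of_poly g * inverse (fps_of_poly g) = 1" using nz by (simp add: inverse_mult_eq_1')
    have "fps_nth (fps_of_poly P * inverse (fps_of_poly g)) v
        = fps_nth (a * fps_of_poly Q * inverse (fps_of_poly g)) v"
      using that PQ by (intro fps_mult_cong_upto[of "p + q"]) (auto simp: pade_pair_def)
    then show ?thesis using inv by (simp add: g fps_of_poly_mult mult.assoc)
  qed
  have pair: "pade_pair p q a (smult c r * P0) (smult c r * Q0)" if r: "degree r \<le> 1" "coeff r 0 = 1" for r
    unfolding pade_pair_def
  proof (intro conjI allI impI)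
    have "degree (smult c r) \<le> 1" using r(1) degree_smult_le[of c r] by linarith
    moreover have "degree Q0 + degree g \<le> q"
      using PQ \<open>g \<noteq> 0\<close> \<open>Q0 \<noteq> 0\<close> by (simp add: pade_pair_def g degree_mult_eq)
    ultimately show "degree (smult c r * Q0) \<le> q"
      using deg degree_mult_le[of "smult c r" Q0] by linarith
    show "degree (smult c r * P0) \<le> p"
    proof (cases "P0 = 0")
      case False
      then have "degree P0 + degree g \<le> p"
        using PQ \<open>g \<noteq> 0\<close> by (simp add: pade_pair_def g degree_mult_eq)
      with \<open>degree (smult c r) \<le> 1\<close> deg degree_mult_le[of "smult c r" P0] show ?thesis by linarith
    qed simp
    show "coeff (smult c r * Q0) 0 = 1" using nz r by (simp add: c_def coeff_mult)
    fix v assume "v \<le> p + q"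
    then have "fps_nth (fps_of_poly P0 * fps_of_poly (smult c r)) v
        = fps_nth (a * fps_of_poly Q0 * fps_of_poly (smult c r)) v"
      using agree by (intro fps_mult_cong_upto[of "p + q"]) auto
    then have "fps_nth (fps_of_poly (smult c r * P0)) v = fps_nth (a * fps_of_poly (smult c r * Q0)) v"
      by (simp only: fps_of_poly_mult mult_ac)
    then show "coeff (smult c r * P0) v = fps_nth (a * fps_of_poly (smult c r * Q0)) v"
      by (simp only: fps_of_poly_nth)
  qed
  have "smult c 1 * Q0 = smult c [:1, 1:] * Q0"
    by (rule pade_pair_unique[OF det pair pair]) auto
  then show False using \<open>Q0 \<noteq> 0\<close> nz(1) by (simp add: c_def)
qed

text \<open>\<open>rat_value\<close> passes to lowest terms. Under the determinant condition the
  given pair differs from these by a constant factor only, so the zeros of \<open>Q\<close> are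
  exactly the poles.\<close>

lemma rat_value_pade:
  assumes det: "Determinant.det (pade_hankel p q a) \<noteq> 0" and PQ: "pade_pair p q a P Q"
  shows "rat_value (pade p q a) w = (if poly Q w = 0 then None else Some (poly P w / poly Q w))"
proof -
  obtain P0 Q0 where q: "quot_of_fract (Fract P Q) = (P0, Q0)" by fastforce
  have "coprime P0 Q0" "Q0 \<noteq> 0"
    using quot_of_fract_in_normalized_fracts[of "Fract P Q"] q by (auto simp: normalized_fracts_def)
  have "Q \<noteq> 0" using PQ by (auto simp: pade_pair_def)
  have "Fract P0 Q0 = Fract P Q"
    using quot_to_fract_quot_of_fract[of "Fract P Q"] q by (simp add: quot_to_fract_def)
  then have cross: "P0 * Q = P * Q0" using \<open>Q \<noteq> 0\<close> \<open>Q0 \<noteq> 0\<close> by (simp add: eq_fract)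
  then have "Q0 dvd P0 * Q" by simp
  then have "Q0 dvd Q" using \<open>coprime P0 Q0\<close> by (simp add: coprime_dvd_mult_right_iff coprime_commute)
  then obtain g where Q: "Q = Q0 * g" by (elim dvdE)
  then have P: "P = P0 * g" using cross \<open>Q0 \<noteq> 0\<close> by (simp add: mult_ac)
  have "degree g = 0" by (rule pade_pair_reduced[OF det PQ P Q])
  then obtain c where "g = [:c:]" by (rule degree_eq_zeroE)
  moreover have "g \<noteq> 0" using \<open>Q \<noteq> 0\<close> Q by auto
  ultimately show ?thesis
    unfolding pade_eq_Fract[OF PQ] rat_value_def q by (simp add: P Q)
qed

text \<open>
  Cramer's solution of the Hankel system multiplied by the Hankel determinant, so that all
  coefficients are polynomials in the coefficients of \<open>a\<close> and no division interferes with limits.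
\<close>

definition pade_den_coeff :: "nat \<Rightarrow> nat \<Rightarrow> complex fps \<Rightarrow> nat \<Rightarrow> complex" where
  "pade_den_coeff p q a k = (if k = 0 then Determinant.det (pade_hankel p q a)
     else \<Sum>i<q. cofactor (pade_hankel p q a) i (q - k) * - int_coeff a (int (p + 1 + i)))"

definition pade_den :: "nat \<Rightarrow> nat \<Rightarrow> complex fps \<Rightarrow> complex poly" where
  "pade_den p q a = (\<Sum>k\<le>q. monom (pade_den_coeff p q a k) k)"

definition pade_num :: "nat \<Rightarrow> nat \<Rightarrow> complex fps \<Rightarrow> complex poly" where
  "pade_num p q a = (\<Sum>v\<le>p. monom (\<Sum>k\<le>q. pade_den_coeff p q a k * int_coeff a (int v - int k)) v)"

lemma coeff_sum_monom: "coeff (\<Sum>k\<le>n. monom (c k) k) v = (if v \<le> n then c v else 0)"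
  by (simp add: coeff_sum)

lemma degree_sum_monom: "degree (\<Sum>k\<le>n. monom (c k) k) \<le> n"
  by (intro degree_sum_le order_trans[OF degree_monom_le]) auto

lemma degree_pade_den: "degree (pade_den p q a) \<le> q"
  unfolding pade_den_def by (rule degree_sum_monom)

text \<open>Up to \<open>p\<close> this is the definition of \<open>pade_num\<close>. For higher
  orders both sides vanish: a matrix times its adjugate is the determinant times the identity, so
  the coefficients of \<open>pade_den\<close> solve the Hankel system scaled by the
  determinant.\<close>

lemma coeff_pade_num:
  "v \<le> p + q \<Longrightarrow> coeff (pade_num p q a) v = fps_nth (a * fps_of_poly (pade_den p q a)) v"
proof -
  assume v: "v \<le> p + q"
  let ?H = "pade_hankel p q a" and ?Q = "pade_den p q a"
  let ?b = "Matrix.vec q (\<lambda>i. - int_coeff a (int (p + 1 + i)))"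
  have coeff: "coeff ?Q k = (if k \<le> q then pade_den_coeff p q a k else 0)" for k
    unfolding pade_den_def by (rule coeff_sum_monom)
  have "Matrix.vec q (\<lambda>j. coeff ?Q (q - j)) = adj_mat ?H *\<^sub>v ?b"
    by (rule eq_vecI)
      (simp_all add: coeff pade_den_coeff_def adj_mat_def scalar_prod_def pade_hankel_def lessThan_atLeast0)
  then have "?H *\<^sub>v Matrix.vec q (\<lambda>j. coeff ?Q (q - j)) = (?H * adj_mat ?H) *\<^sub>v ?b"
    using adj_mat(1)[OF pade_hankel_carrier] pade_hankel_carrier
    by (simp add: assoc_mult_mat_vec[of _ q q _ q])
  also have "\<dots> = Determinant.det ?H \<cdot>\<^sub>v ?b"
    unfolding adj_mat(2)[OF pade_hankel_carrier]
    by (rule eq_vecI) (simp_all add: scalar_prod_def if_distrib if_distribR cong: if_cong)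
  also have "\<dots> = Matrix.vec q (\<lambda>i. - (coeff ?Q 0 * int_coeff a (int (p + 1 + i))))"
    by (rule eq_vecI) (simp_all add: coeff pade_den_coeff_def)
  finally have zero: "\<forall>v. p < v \<and> v \<le> p + q \<longrightarrow> fps_nth (a * fps_of_poly ?Q) v = 0"
    using pade_equations_iff[OF degree_pade_den] by blast
  show ?thesis
  proof (cases "v \<le> p")
    case True
    then show ?thesis
      unfolding fps_nth_mult_poly[OF degree_pade_den] coeff
      by (simp add: pade_num_def coeff_sum_monom)
  next
    case False
    then show ?thesis
      using v zero by (simp add: pade_num_def coeff_sum_monom)
  qed
qed

lemma rat_value_pade_explicit:
  assumes det: "Determinant.det (pade_hankel p q a) \<noteq> 0"
  shows "rat_value (pade p q a) w = (if poly (pade_den p q a) w = 0 then None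
    else Some (poly (pade_num p q a) w / poly (pade_den p q a) w))"
proof -
  let ?c = "1 / Determinant.det (pade_hankel p q a)"
  have "coeff (pade_den p q a) 0 = Determinant.det (pade_hankel p q a)"
    unfolding pade_den_def coeff_sum_monom by (simp add: pade_den_coeff_def)
  moreover have "degree (pade_num p q a) \<le> p" unfolding pade_num_def by (rule degree_sum_monom)
  ultimately have "pade_pair p q a (smult ?c (pade_num p q a)) (smult ?c (pade_den p q a))"
    using det degree_pade_den[of p q a] coeff_pade_num[of _ p q a]
    by (simp add: pade_pair_def fps_of_poly_smult mult.left_commute[of a "fps_const c" for c])
  from rat_value_pade[OF det this] show ?thesis using det by simp
qed

section \<open>Continuity in the Taylor coefficients\<close>

lemma tendsto_det:
  fixes A :: "nat \<Rightarrow> complex Matrix.mat"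
  assumes "\<And>n. A n \<in> carrier_mat m m" "B \<in> carrier_mat m m"
    and "\<And>i j. i < m \<Longrightarrow> j < m \<Longrightarrow> (\<lambda>n. A n $$ (i, j)) \<longlonglongrightarrow> B $$ (i, j)"
  shows "(\<lambda>n. Determinant.det (A n)) \<longlonglongrightarrow> Determinant.det B"
proof -
  have "(\<lambda>n. \<Sum>\<pi> | \<pi> permutes {0..<m}. signof \<pi> * (\<Prod>i = 0..<m. A n $$ (i, \<pi> i))) \<longlonglongrightarrow>
      (\<Sum>\<pi> | \<pi> permutes {0..<m}. signof \<pi> * (\<Prod>i = 0..<m. B $$ (i, \<pi> i)))"
    by (intro tendsto_sum tendsto_mult tendsto_const tendsto_prod assms(3)) (auto simp: permutes_in_image)
  then show ?thesis by (simp add: det_def'[OF assms(1)] det_def'[OF assms(2)])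
qed

context
  fixes A :: "nat \<Rightarrow> complex fps" and a :: "complex fps" and p q :: nat
  assumes lim: "\<And>v. (\<lambda>n. fps_nth (A n) v) \<longlonglongrightarrow> fps_nth a v"
begin

lemma tendsto_int_coeff: "(\<lambda>n. int_coeff (A n) k) \<longlonglongrightarrow> int_coeff a k"
  by (cases "k < 0") (simp_all add: int_coeff_def lim)

lemma tendsto_det_pade_hankel:
  "(\<lambda>n. Determinant.det (pade_hankel p q (A n))) \<longlonglongrightarrow> Determinant.det (pade_hankel p q a)"
  by (rule tendsto_det[OF pade_hankel_carrier pade_hankel_carrier])
    (simp add: pade_hankel_def tendsto_int_coeff)

lemma tendsto_pade_den_coeff:
  assumes "k \<le> q"
  shows "(\<lambda>n. pade_den_coeff p q (A n) k) \<longlonglongrightarrow> pade_den_coeff p q a k"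
proof (cases "k = 0")
  case True
  then show ?thesis by (simp add: pade_den_coeff_def tendsto_det_pade_hankel)
next
  case False
  have "(\<lambda>n. cofactor (pade_hankel p q (A n)) i (q - k)) \<longlonglongrightarrow> cofactor (pade_hankel p q a) i (q - k)"
    if "i < q" for i
    unfolding cofactor_def
    by (intro tendsto_mult tendsto_const tendsto_det[of _ "q - 1"] mat_delete_carrier pade_hankel_carrier)
      (use assms False that in \<open>auto simp: mat_delete_def pade_hankel_def tendsto_int_coeff\<close>)
  with False show ?thesis
    unfolding pade_den_coeff_def
    by (auto intro!: tendsto_sum tendsto_mult tendsto_minus tendsto_int_coeff)
qed

lemma tendsto_poly_pade:
  assumes "w \<longlonglongrightarrow> w0"
  shows "(\<lambda>n. poly (pade_den p q (A n)) (w n)) \<longlonglongrightarrow> poly (pade_den p q a) w0"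
    and "(\<lambda>n. poly (pade_num p q (A n)) (w n)) \<longlonglongrightarrow> poly (pade_num p q a) w0"
  unfolding pade_den_def pade_num_def poly_sum poly_monom
  by (intro tendsto_sum tendsto_mult tendsto_power assms tendsto_pade_den_coeff tendsto_int_coeff; simp)+

end

section \<open>Hankel determinants of polynomials\<close>

lemma det_pade_hankel_poly:
  assumes "G \<noteq> 0"
  shows "Determinant.det (pade_hankel (degree G) q (fps_of_poly G)) \<noteq> 0"
proof -
  let ?H = "pade_hankel (degree G) q (fps_of_poly G)"
  \<comment> \<open>Reversing the rows moves the antidiagonal to the diagonal. The entry at
    \<open>(i, j)\<close> then has index \<open>degree G + j - i\<close>, beyond the degree when
    \<open>i < j\<close>.\<close>
  let ?r = "\<lambda>i. if i < q then q - 1 - i else i"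
  let ?M = "Matrix.mat q q (\<lambda>(i, j). ?H $$ (?r i, j))"
  have perm: "?r permutes {0..<q}"
    by (rule bij_imp_permutes, rule bij_betw_byWitness[of _ ?r]) auto
  have entry: "?M $$ (i, j) = int_coeff (fps_of_poly G) (int (degree G) + int j - int i)"
    if "i < q" "j < q" for i j
    using that by (simp add: pade_hankel_def of_nat_diff algebra_simps)
  have "Determinant.det ?M = prod_list (diag_mat ?M)"
  proof (rule det_lower_triangular)
    show "?M $$ (i, j) = 0" if "i < j" "j < q" for i j
      unfolding entry[OF less_trans[OF that] that(2)] using that
      by (simp add: int_coeff_def coeff_eq_0)
  qed simp
  also have "diag_mat ?M = replicate q (lead_coeff G)"
  proof (rule nth_equalityI)
    fix i assume "i < length (diag_mat ?M)"
    then have i: "i < q" by (simp add: diag_mat_def)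
    have "diag_mat ?M ! i = ?M $$ (i, i)" using i by (simp add: diag_mat_def)
    also have "\<dots> = lead_coeff G" unfolding entry[OF i i] by (simp add: int_coeff_def)
    finally show "diag_mat ?M ! i = replicate q (lead_coeff G) ! i" using i by simp
  qed (simp add: diag_mat_def)
  finally have "Determinant.det ?M \<noteq> 0" using assms by (simp add: prod_list_replicate)
  then show ?thesis using Determinant.det_permute_rows[OF pade_hankel_carrier perm, of "degree G" "fps_of_poly G"] by auto
qed

lemma rat_value_pade_poly:
  assumes "G \<noteq> 0"
  shows "rat_value (pade (degree G) q (fps_of_poly G)) w = Some (poly G w)"
proof -
  have "pade_pair (degree G) q (fps_of_poly G) G 1" by (simp add: pade_pair_def)
  from rat_value_pade[OF det_pade_hankel_poly[OF assms] this] show ?thesis by simp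
qed

subsection \<open>Openness of the approximation condition\<close>

lemma has_fps_expansion_poly: "poly (p :: complex poly) has_fps_expansion fps_of_poly p"
proof (induction p)
  case (pCons c p)
  have "(\<lambda>x. c + x * poly p x) has_fps_expansion fps_const c + fps_X * fps_of_poly p"
    by (intro fps_expansion_intros pCons.IH)
  then show ?case by (simp add: fps_of_poly_pCons mult.commute)
qed (use has_fps_expansion_const[of "0 :: complex"] in simp)

lemma fps_expansion_poly:
  assumes "open \<Omega>" "\<zeta> \<in> \<Omega>" "\<And>z. z \<in> \<Omega> \<Longrightarrow> f z = poly G z"
  shows "fps_expansion f \<zeta> = fps_of_poly (pcompose G [:\<zeta>, 1:])"
proof -
  have "fps_expansion f \<zeta> = fps_expansion (poly G) \<zeta>"
    using assms by (intro fps_expansion_cong eventually_nhds_in_open[THEN eventually_mono]) auto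
  moreover have "(\<lambda>x. poly G (\<zeta> + x)) has_fps_expansion fps_expansion (poly G) \<zeta>"
    by (intro analytic_at_imp_has_fps_expansion) (auto simp: analytic_on_holomorphic intro!: exI[of _ UNIV] holomorphic_intros)
  moreover have "(\<lambda>x. poly G (\<zeta> + x)) has_fps_expansion fps_of_poly (pcompose G [:\<zeta>, 1:])"
  proof -
    have "(\<lambda>x. poly G (\<zeta> + x)) = poly (pcompose G [:\<zeta>, 1:])" by (rule ext) (simp add: poly_pcompose)
    then show ?thesis using has_fps_expansion_poly by simp
  qed
  ultimately show ?thesis using fps_expansion_unique_complex by metis
qed

text \<open>Function and centre vary together. Cauchy's inequality on discs of the common radius
  \<open>r\<close> controls the change of function uniformly in the centre; continuity of the
  derivatives of \<open>f\<close> takes care of the moving centre.\<close>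

lemma tendsto_fps_expansion:
  fixes g :: "nat \<Rightarrow> complex \<Rightarrow> complex"
  assumes \<Omega>: "open \<Omega>" and f: "f holomorphic_on \<Omega>" and g: "\<And>n. g n holomorphic_on \<Omega>"
    and r: "r > 0" and K: "\<And>x. x \<in> K \<Longrightarrow> cball x r \<subseteq> \<Omega>"
    and close: "\<And>n x z. x \<in> K \<Longrightarrow> z \<in> cball x r \<Longrightarrow> dist (g n z) (f z) \<le> \<epsilon> n" and \<epsilon>: "\<epsilon> \<longlonglongrightarrow> 0"
    and \<zeta>: "\<And>n. \<zeta> n \<in> K" "\<zeta> \<longlonglongrightarrow> \<xi>" and \<xi>: "\<xi> \<in> \<Omega>"
  shows "(\<lambda>n. fps_nth (fps_expansion (g n) (\<zeta> n)) v) \<longlonglongrightarrow> fps_nth (fps_expansion f \<xi>) v"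
proof -
  have bound: "norm ((deriv ^^ v) (g n) (\<zeta> n) - (deriv ^^ v) f (\<zeta> n)) \<le> fact v * \<epsilon> n / r ^ v" for n
  proof -
    have in_\<Omega>: "cball (\<zeta> n) r \<subseteq> \<Omega>" by (rule K[OF \<zeta>(1)])
    then have "\<zeta> n \<in> \<Omega>" using r by auto
    have hol: "(\<lambda>w. g n w - f w) holomorphic_on \<Omega>" by (intro holomorphic_intros f g)
    have "norm ((deriv ^^ v) (\<lambda>w. g n w - f w) (\<zeta> n)) \<le> fact v * \<epsilon> n / r ^ v"
    proof (rule Cauchy_inequality[OF _ _ r])
      show "(\<lambda>w. g n w - f w) holomorphic_on ball (\<zeta> n) r"
        using hol in_\<Omega> ball_subset_cball holomorphic_on_subset by blast
      show "continuous_on (cball (\<zeta> n) r) (\<lambda>w. g n w - f w)"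
        using hol in_\<Omega> holomorphic_on_imp_continuous_on continuous_on_subset by blast
      fix x assume "norm (\<zeta> n - x) = r"
      then show "norm (g n x - f x) \<le> \<epsilon> n"
        using close[OF \<zeta>(1)[of n], of x n] by (simp add: dist_norm)
    qed
    then show ?thesis
      using higher_deriv_diff[OF g f \<Omega> \<open>\<zeta> n \<in> \<Omega>\<close>] by simp
  qed
  have "(\<lambda>n. fact v * \<epsilon> n / r ^ v) \<longlonglongrightarrow> fact v * 0 / r ^ v"
    using r by (intro tendsto_divide[OF tendsto_mult[OF tendsto_const \<epsilon>] tendsto_const]) simp
  then have lim0: "(\<lambda>n. fact v * \<epsilon> n / r ^ v) \<longlonglongrightarrow> 0" by simp
  have "(\<lambda>n. (deriv ^^ v) (g n) (\<zeta> n) - (deriv ^^ v) f (\<zeta> n)) \<longlonglongrightarrow> 0"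
    by (rule Lim_null_comparison[OF always_eventually lim0]) (use bound in blast)
  moreover have "continuous_on \<Omega> ((deriv ^^ v) f)"
    by (intro holomorphic_on_imp_continuous_on holomorphic_higher_deriv f \<Omega>)
  then have "isCont ((deriv ^^ v) f) \<xi>" using \<Omega> \<xi> by (simp add: continuous_on_eq_continuous_at)
  then have "(\<lambda>n. (deriv ^^ v) f (\<zeta> n)) \<longlonglongrightarrow> (deriv ^^ v) f \<xi>"
    using \<zeta>(2) by (rule isCont_tendsto_compose)
  ultimately have "(\<lambda>n. ((deriv ^^ v) (g n) (\<zeta> n) - (deriv ^^ v) f (\<zeta> n)) + (deriv ^^ v) f (\<zeta> n)) \<longlonglongrightarrow> 0 + (deriv ^^ v) f \<xi>"
    by (rule tendsto_add)
  then have "(\<lambda>n. (deriv ^^ v) (g n) (\<zeta> n) / fact v) \<longlonglongrightarrow> (deriv ^^ v) f \<xi> / fact v"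
    by (intro tendsto_divide tendsto_const) simp_all
  then show ?thesis by (simp add: fps_expansion_def)
qed

definition pade_error :: "nat \<Rightarrow> nat \<Rightarrow> (complex \<Rightarrow> complex) \<Rightarrow> complex set \<Rightarrow> ennreal" where
  "pade_error p q f K = (SUP \<zeta>\<in>K. SUP z\<in>K. sphere_error (pade_value p q f \<zeta> z) (f z))"

definition pade_close :: "complex set \<Rightarrow> complex set \<Rightarrow> ennreal \<Rightarrow> nat \<Rightarrow> nat \<Rightarrow> (complex \<Rightarrow> complex) set" where
  "pade_close \<Omega> K \<delta> p q =
     {f \<in> hol_space \<Omega>. (\<forall>\<zeta>\<in>K. f \<in> pade_normal p q \<zeta>) \<and> pade_error p q f K < \<delta>}"

lemma sphere_error_pade_value:
  assumes "f \<in> pade_normal p q \<zeta>"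
  shows "sphere_error (pade_value p q f \<zeta> z) c = (let a = fps_expansion f \<zeta> in
    if poly (pade_den p q a) (z - \<zeta>) = 0 then \<infinity>
    else ennreal (norm (poly (pade_num p q a) (z - \<zeta>) / poly (pade_den p q a) (z - \<zeta>) - c)))"
  using assms by (simp add: pade_value_def pade_normal_def Let_def rat_value_pade_explicit)

text \<open>If no neighbourhood of \<open>f\<close> worked, functions tending to \<open>f\<close>
  would fail at certain centres and arguments. Along a subsequence these converge in
  \<open>K \<times> K\<close>; determinants, denominators and errors converge to those of
  \<open>f\<close>, where strict inequalities hold.\<close>

lemma hol_open_pade_close:
  assumes \<Omega>: "open \<Omega>" and K: "compact K" "K \<subseteq> \<Omega>"
  shows "hol_open \<Omega> (pade_close \<Omega> K \<delta> p q)"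
  unfolding hol_open_def
proof (intro conjI ballI)
  show "pade_close \<Omega> K \<delta> p q \<subseteq> hol_space \<Omega>" by (auto simp: pade_close_def)
  fix f assume f: "f \<in> pade_close \<Omega> K \<delta> p q"
  then have fh: "f holomorphic_on \<Omega>" and normal: "\<And>\<zeta>. \<zeta> \<in> K \<Longrightarrow> f \<in> pade_normal p q \<zeta>"
    by (auto simp: pade_close_def hol_space_def)
  \<comment> \<open>A supremum of at least \<delta> need not be attained, but some single error
    exceeds \<delta>'; the errors of \<open>f\<close> stay strictly below \<delta>'.\<close>
  obtain \<delta>' where \<delta>': "pade_error p q f K < \<delta>'" "\<delta>' < \<delta>"
    using f dense[of "pade_error p q f K" \<delta>] by (auto simp: pade_close_def)
  obtain d where d: "d > 0" "(\<Union>x\<in>K. ball x d) \<subseteq> \<Omega>"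
    using compact_subset_open_imp_ball_epsilon_subset[OF K(1) \<Omega> K(2)] by blast
  define r where "r = d / 2"
  have r: "r > 0" "r < d" using d(1) by (auto simp: r_def)
  \<comment> \<open>The closed \<open>r\<close>-neighbourhood of \<open>K\<close>, as a sum of
    compact sets. Taylor coefficients at points of \<open>K\<close> are controlled by values on
    circles of radius \<open>r\<close>, which leave \<open>K\<close>.\<close>
  define L where "L = (\<Union>x\<in>K. \<Union>y\<in>cball 0 r. {x + y})"
  have L: "x \<in> K \<Longrightarrow> z \<in> cball x r \<Longrightarrow> z \<in> L" for x z
    unfolding L_def by (rule UN_I[of x], simp, rule UN_I[of "z - x"]) (auto simp: dist_norm norm_minus_commute)
  have cball: "cball x r \<subseteq> \<Omega>" if "x \<in> K" for x
    using that d(2) r(2) by (force simp: subset_iff)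
  have "compact L" unfolding L_def by (rule compact_sums'[OF K(1) compact_cball])
  moreover have "L \<subseteq> \<Omega>"
  proof
    fix z assume "z \<in> L"
    then obtain x y where "x \<in> K" "y \<in> cball 0 r" "z = x + y" unfolding L_def by blast
    then have "z \<in> cball x r" by (simp add: dist_norm)
    then show "z \<in> \<Omega>" using cball[OF \<open>x \<in> K\<close>] by blast
  qed
  moreover have "\<exists>n. {g \<in> hol_space \<Omega>. \<forall>z\<in>L. dist (g z) (f z) < 1 / real (Suc n)} \<subseteq> pade_close \<Omega> K \<delta> p q"
  proof (rule ccontr)
    assume "\<not> ?thesis"
    then have "\<forall>n. \<exists>g. g \<in> hol_space \<Omega> \<and> (\<forall>z\<in>L. dist (g z) (f z) < 1 / real (Suc n)) \<and> g \<notin> pade_close \<Omega> K \<delta> p q"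
      by (auto simp: subset_iff)
    then obtain g where g: "\<And>n. g n \<in> hol_space \<Omega>"
      "\<And>n z. z \<in> L \<Longrightarrow> dist (g n z) (f z) < 1 / real (Suc n)" "\<And>n. g n \<notin> pade_close \<Omega> K \<delta> p q"
      by metis
    \<comment> \<open>The implication records both ways of failing: at a centre that is not normal
      it holds vacuously, with any \<open>z\<close> in \<open>K\<close>.\<close>
    have "\<exists>\<zeta> z. \<zeta> \<in> K \<and> z \<in> K \<and> (g n \<in> pade_normal p q \<zeta> \<longrightarrow> \<delta>' < sphere_error (pade_value p q (g n) \<zeta> z) (g n z))" for n
    proof (cases "\<forall>\<zeta>\<in>K. g n \<in> pade_normal p q \<zeta>")
      case True
      then have "\<not> pade_error p q (g n) K < \<delta>" using g(1,3)[of n] by (auto simp: pade_close_def)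
      with \<delta>'(2) have "\<delta>' < pade_error p q (g n) K" by (simp add: not_less)
      then show ?thesis unfolding pade_error_def less_SUP_iff by blast
    qed blast
    then obtain \<zeta> z where bad: "\<And>n. \<zeta> n \<in> K" "\<And>n. z n \<in> K"
      "\<And>n. g n \<in> pade_normal p q (\<zeta> n) \<Longrightarrow> \<delta>' < sphere_error (pade_value p q (g n) (\<zeta> n) (z n)) (g n (z n))"
      by metis
    have "seq_compact (K \<times> K)" using K(1) by (intro compact_imp_seq_compact compact_Times)
    moreover have "\<forall>n. (\<zeta> n, z n) \<in> K \<times> K" using bad by simp
    ultimately obtain l s where l: "l \<in> K \<times> K" "strict_mono s" "((\<lambda>n. (\<zeta> n, z n)) \<circ> s) \<longlonglongrightarrow> l"
      by (rule seq_compactE)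
    define \<xi> x where "\<xi> = fst l" and "x = snd l"
    have lK: "\<xi> \<in> K" "x \<in> K" using l(1) by (auto simp: \<xi>_def x_def)
    have \<zeta>_lim: "(\<lambda>n. \<zeta> (s n)) \<longlonglongrightarrow> \<xi>" and z_lim: "(\<lambda>n. z (s n)) \<longlonglongrightarrow> x"
      using tendsto_fst[OF l(3)] tendsto_snd[OF l(3)] by (simp_all add: \<xi>_def x_def o_def)
    let ?a = "fps_expansion f \<xi>" and ?A = "\<lambda>n. fps_expansion (g (s n)) (\<zeta> (s n))"
    have gs: "dist (g (s n) z) (f z) \<le> 1 / real (Suc n)" if "z \<in> L" for n z
    proof -
      have "1 / real (Suc (s n)) \<le> 1 / real (Suc n)"
        using seq_suble[OF l(2), of n] by (intro divide_left_mono) auto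
      with g(2)[OF that, of "s n"] show ?thesis by linarith
    qed
    have inv_lim: "(\<lambda>n. 1 / real (Suc n)) \<longlonglongrightarrow> 0"
      using LIMSEQ_inverse_real_of_nat by (simp add: inverse_eq_divide)
    have A: "(\<lambda>n. fps_nth (?A n) v) \<longlonglongrightarrow> fps_nth ?a v" for v
    proof (rule tendsto_fps_expansion[OF \<Omega> fh _ r(1) cball _ inv_lim _ \<zeta>_lim])
      show "g (s n) holomorphic_on \<Omega>" for n using g(1) by (simp add: hol_space_def)
      show "dist (g (s n) z) (f z) \<le> 1 / real (Suc n)" if "x \<in> K" "z \<in> cball x r" for n x z
        by (rule gs[OF L[OF that]])
      show "\<zeta> (s n) \<in> K" for n by (rule bad(1))
      show "\<xi> \<in> \<Omega>" using lK(1) K(2) by blast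
    qed
    have g_lim: "(\<lambda>n. g (s n) (z (s n))) \<longlonglongrightarrow> f x"
    proof -
      have "z (s n) \<in> L" for n using L[OF bad(2)[of "s n"], of "z (s n)"] r(1) by simp
      then have "norm (g (s n) (z (s n)) - f (z (s n))) \<le> 1 / real (Suc n)" for n
        using gs by (simp add: dist_norm)
      then have "(\<lambda>n. g (s n) (z (s n)) - f (z (s n))) \<longlonglongrightarrow> 0"
        by (intro Lim_null_comparison[OF _ inv_lim]) auto
      moreover have "isCont f x"
        using holomorphic_on_imp_continuous_on[OF fh] \<Omega> lK K(2) by (auto simp: continuous_on_eq_continuous_at)
      then have "(\<lambda>n. f (z (s n))) \<longlonglongrightarrow> f x" using z_lim by (rule isCont_tendsto_compose)
      ultimately have "(\<lambda>n. (g (s n) (z (s n)) - f (z (s n))) + f (z (s n))) \<longlonglongrightarrow> 0 + f x"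
        by (rule tendsto_add)
      then show ?thesis by simp
    qed
    have ev_normal: "\<forall>\<^sub>F n in sequentially. g (s n) \<in> pade_normal p q (\<zeta> (s n))"
      using tendsto_imp_eventually_ne[OF tendsto_det_pade_hankel[OF A]] normal[OF lK(1)]
      by (simp add: pade_normal_def)
    have "sphere_error (pade_value p q f \<xi> x) (f x) < \<delta>'"
      using SUP_lessD[OF SUP_lessD[OF \<delta>'(1)[unfolded pade_error_def] lK(1)] lK(2)] .
    note err' = this[unfolded sphere_error_pade_value[OF normal[OF lK(1)]] Let_def]
    \<comment> \<open>A pole would have infinite error, which is not below \<delta>'.\<close>
    have den: "poly (pade_den p q ?a) (x - \<xi>) \<noteq> 0"
    proof
      assume "poly (pade_den p q ?a) (x - \<xi>) = 0"
      with err' show False by simp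
    qed
    with err' have err: "ennreal (norm (poly (pade_num p q ?a) (x - \<xi>) / poly (pade_den p q ?a) (x - \<xi>) - f x)) < \<delta>'"
      by (simp only: if_False)
    let ?w = "\<lambda>n. z (s n) - \<zeta> (s n)"
    have w: "?w \<longlonglongrightarrow> x - \<xi>" by (intro tendsto_diff z_lim \<zeta>_lim)
    note lims = tendsto_poly_pade[OF A w]
    have ev_den: "\<forall>\<^sub>F n in sequentially. poly (pade_den p q (?A n)) (?w n) \<noteq> 0"
      using tendsto_imp_eventually_ne[OF lims(1) den] .
    have "(\<lambda>n. ennreal (norm (poly (pade_num p q (?A n)) (?w n) / poly (pade_den p q (?A n)) (?w n) - g (s n) (z (s n)))))
        \<longlonglongrightarrow> ennreal (norm (poly (pade_num p q ?a) (x - \<xi>) / poly (pade_den p q ?a) (x - \<xi>) - f x))"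
      by (intro tendsto_ennrealI tendsto_norm tendsto_diff tendsto_divide lims g_lim den)
    from order_tendstoD(2)[OF this err]
    have "\<forall>\<^sub>F n in sequentially. ennreal (norm (poly (pade_num p q (?A n)) (?w n) / poly (pade_den p q (?A n)) (?w n) - g (s n) (z (s n)))) < \<delta>'" .
    with ev_normal ev_den have "\<forall>\<^sub>F n in sequentially. False"
    proof eventually_elim
      case (elim n)
      then show ?case
        using bad(3)[OF elim(1)] unfolding sphere_error_pade_value[OF elim(1)] Let_def by simp
    qed
    then show False by simp
  qed
  then obtain n where "{g \<in> hol_space \<Omega>. \<forall>z\<in>L. dist (g z) (f z) < 1 / real (Suc n)} \<subseteq> pade_close \<Omega> K \<delta> p q" ..
  ultimately show "\<exists>L \<epsilon>. compact L \<and> L \<subseteq> \<Omega> \<and> \<epsilon> > 0 \<and>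
      {g \<in> hol_space \<Omega>. \<forall>z\<in>L. dist (g z) (f z) < \<epsilon>} \<subseteq> pade_close \<Omega> K \<delta> p q"
    by (intro exI[of _ L] exI[of _ "1 / real (Suc n)"]) auto
qed

lemma poly_in_pade_close:
  assumes "open \<Omega>" "K \<subseteq> \<Omega>" "\<delta> > 0" "G \<noteq> 0"
  shows "restrict (poly G) \<Omega> \<in> pade_close \<Omega> K \<delta> (degree G) q"
proof -
  let ?f = "restrict (poly G) \<Omega>" and ?G = "\<lambda>\<zeta>. pcompose G [:\<zeta>, 1:]"
  have exp: "fps_expansion ?f \<zeta> = fps_of_poly (?G \<zeta>)" if "\<zeta> \<in> K" for \<zeta>
    by (rule fps_expansion_poly[OF assms(1)]) (use that assms(2) in auto)
  have deg: "degree (?G \<zeta>) = degree G" "?G \<zeta> \<noteq> 0" for \<zeta>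
    using assms(4) by (simp_all add: degree_pcompose pcompose_eq_0_iff)
  have "?f \<in> pade_normal (degree G) q \<zeta>" if "\<zeta> \<in> K" for \<zeta>
    using det_pade_hankel_poly[OF deg(2), of \<zeta> q] unfolding pade_normal_def mem_Collect_eq exp[OF that] deg(1) .
  moreover have "sphere_error (pade_value (degree G) q ?f \<zeta> z) (?f z) = 0" if "\<zeta> \<in> K" "z \<in> K" for \<zeta> z
    using rat_value_pade_poly[OF deg(2), of \<zeta> q "z - \<zeta>"] that assms(2)
    unfolding pade_value_def exp[OF that(1)] deg(1) by (simp add: poly_pcompose subset_iff)
  then have "pade_error (degree G) q ?f K \<le> 0"
    unfolding pade_error_def by (intro SUP_least) simp
  moreover have "(\<lambda>z. poly G z) holomorphic_on \<Omega>" by (intro holomorphic_intros)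
  then have "?f holomorphic_on \<Omega>" by (rule holomorphic_transform) simp
  then have "?f \<in> hol_space \<Omega>" by (simp add: hol_space_def)
  ultimately show ?thesis using assms(3) by (auto simp: pade_close_def)
qed

subsection \<open>Baire's theorem in the space of holomorphic functions\<close>

text \<open>
  Density in \<^term>\<open>hol_topology \<Omega>\<close> is used in this metric form, which avoids having to know that
  the basic neighbourhoods are open.
\<close>

definition hol_dense :: "complex set \<Rightarrow> (complex \<Rightarrow> complex) set \<Rightarrow> bool" where
  "hol_dense \<Omega> U \<longleftrightarrow> (\<forall>f\<in>hol_space \<Omega>. \<forall>K \<epsilon>. compact K \<longrightarrow> K \<subseteq> \<Omega> \<longrightarrow> \<epsilon> > 0 \<longrightarrow>
     (\<exists>g\<in>U \<inter> hol_space \<Omega>. \<forall>z\<in>K. dist (g z) (f z) < \<epsilon>))"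

lemma closure_of_hol_dense:
  assumes "hol_dense \<Omega> U"
  shows "hol_topology \<Omega> closure_of U = hol_space \<Omega>"
proof
  show "hol_topology \<Omega> closure_of U \<subseteq> hol_space \<Omega>"
    using closure_of_subset_topspace[of "hol_topology \<Omega>" U] by simp
  show "hol_space \<Omega> \<subseteq> hol_topology \<Omega> closure_of U"
  proof
    fix f assume f: "f \<in> hol_space \<Omega>"
    have "\<exists>y. y \<in> U \<and> y \<in> T" if T: "f \<in> T" "hol_open \<Omega> T" for T
    proof -
      obtain K \<epsilon> where K: "compact K" "K \<subseteq> \<Omega>" "\<epsilon> > 0" "{g \<in> hol_space \<Omega>. \<forall>z\<in>K. dist (g z) (f z) < \<epsilon>} \<subseteq> T"
        using T unfolding hol_open_def by blast
      with assms f obtain g where "g \<in> U \<inter> hol_space \<Omega>" "\<forall>z\<in>K. dist (g z) (f z) < \<epsilon>"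
        unfolding hol_dense_def by blast
      with K(4) show ?thesis by blast
    qed
    with f show "f \<in> hol_topology \<Omega> closure_of U" by (simp add: in_closure_of openin_hol_topology)
  qed
qed

text \<open>Non-strict inequalities survive the limit taken in the Baire argument.\<close>

lemma hol_open_cball:
  assumes U: "hol_open \<Omega> U" and g: "g \<in> U"
  shows "\<exists>K \<epsilon>. compact K \<and> K \<subseteq> \<Omega> \<and> \<epsilon> > 0 \<and> {h \<in> hol_space \<Omega>. \<forall>z\<in>K. dist (h z) (g z) \<le> \<epsilon>} \<subseteq> U"
proof -
  obtain K \<epsilon> where K: "compact K" "K \<subseteq> \<Omega>" "\<epsilon> > 0" "{h \<in> hol_space \<Omega>. \<forall>z\<in>K. dist (h z) (g z) < \<epsilon>} \<subseteq> U"
    using assms unfolding hol_open_def by blast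
  have "dist (h z) (g z) < \<epsilon>" if "dist (h z) (g z) \<le> \<epsilon> / 2" for h z using that K(3) by linarith
  then have "{h \<in> hol_space \<Omega>. \<forall>z\<in>K. dist (h z) (g z) \<le> \<epsilon> / 2} \<subseteq> U" using K(4) by blast
  with K(1-3) show ?thesis by (intro exI[of _ K] exI[of _ "\<epsilon> / 2"]) auto
qed

text \<open>Completeness with the bounds retained: staying within \<open>e n\<close> of
  \<open>g n\<close> on \<open>L n\<close> is what later puts the limit into each open set.\<close>

lemma hol_space_locally_uniform_limit:
  assumes \<Omega>: "open \<Omega>" and g: "\<And>n. g n \<in> hol_space \<Omega>"
    and L: "\<And>n. exhaustion \<Omega> n \<subseteq> L n" "\<And>n. L n \<subseteq> \<Omega>" "\<And>m n. n \<le> m \<Longrightarrow> L n \<subseteq> L m"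
    and e: "e \<longlonglongrightarrow> 0"
    and close: "\<And>m n z. n \<le> m \<Longrightarrow> z \<in> L n \<Longrightarrow> dist (g m z) (g n z) \<le> e n"
  shows "\<exists>h\<in>hol_space \<Omega>. \<forall>n. \<forall>z\<in>L n. dist (h z) (g n z) \<le> e n"
proof -
  have small: "\<exists>M. \<forall>n\<ge>M. e n < \<epsilon>" if "\<epsilon> > 0" for \<epsilon>
    using order_tendstoD(2)[OF e that] by (simp add: eventually_sequentially)
  have conv: "convergent (\<lambda>m. g m z)" if z: "z \<in> L n" for z n
  proof -
    have "Cauchy (\<lambda>m. g m z)"
    proof (rule metric_CauchyI)
      fix \<epsilon> :: real assume "\<epsilon> > 0"
      then obtain M where M: "\<And>k. k \<ge> M \<Longrightarrow> e k < \<epsilon> / 2" using small[of "\<epsilon> / 2"] by auto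
      let ?k = "max M n"
      have "z \<in> L ?k" using L(3)[of n ?k] z by auto
      then have "dist (g i z) (g ?k z) < \<epsilon> / 2" if "i \<ge> ?k" for i
        using close[OF that, of z] M[of ?k] by simp
      then have "dist (g i z) (g j z) < \<epsilon>" if "i \<ge> ?k" "j \<ge> ?k" for i j
        using dist_triangle_half_l that by blast
      then show "\<exists>M. \<forall>m\<ge>M. \<forall>n\<ge>M. dist (g m z) (g n z) < \<epsilon>" by blast
    qed
    then show ?thesis by (simp add: Cauchy_convergent_iff)
  qed
  define h where "h = restrict (\<lambda>z. lim (\<lambda>m. g m z)) \<Omega>"
  have lim: "(\<lambda>m. g m z) \<longlonglongrightarrow> h z" if "z \<in> L n" for z n
    using conv[OF that] L(2)[of n] that by (auto simp: h_def convergent_LIMSEQ_iff)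
  have bound: "dist (h z) (g n z) \<le> e n" if z: "z \<in> L n" for z n
  proof (rule tendsto_upperbound)
    show "(\<lambda>m. dist (g m z) (g n z)) \<longlonglongrightarrow> dist (h z) (g n z)"
      by (intro tendsto_dist lim[OF z] tendsto_const)
    show "\<forall>\<^sub>F m in sequentially. dist (g m z) (g n z) \<le> e n"
      using close[of n _ z] z by (auto simp: eventually_sequentially)
  qed simp
  have "h holomorphic_on \<Omega>"
  proof (rule holomorphic_uniform_sequence[OF \<Omega>, of g])
    show "g n holomorphic_on \<Omega>" for n using g by (simp add: hol_space_def)
    fix x assume "x \<in> \<Omega>"
    then obtain n where "x \<in> interior (exhaustion \<Omega> n)"
      using compact_subset_interior_exhaustion[OF \<Omega>, of "{x}"] by auto
    then obtain d where d: "d > 0" "cball x d \<subseteq> interior (exhaustion \<Omega> n)"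
      by (meson open_contains_cball open_interior)
    then have sub: "cball x d \<subseteq> L n" using L(1)[of n] interior_subset[of "exhaustion \<Omega> n"] by blast
    have "uniform_limit (cball x d) g h sequentially"
    proof (rule uniform_limitI)
      fix \<epsilon> :: real assume "\<epsilon> > 0"
      then obtain M where M: "\<And>k. k \<ge> M \<Longrightarrow> e k < \<epsilon>" using small by auto
      have "dist (g k y) (h y) < \<epsilon>" if k: "k \<ge> max M n" and y: "y \<in> cball x d" for k y
      proof -
        have "y \<in> L k" using L(3)[of n k] sub k y by (meson max.boundedE subsetD)
        then have "dist (h y) (g k y) \<le> e k" by (rule bound)
        also have "\<dots> < \<epsilon>" using M k by simp
        finally show ?thesis by (simp add: dist_commute)
      qed
      then show "\<forall>\<^sub>F k in sequentially. \<forall>y\<in>cball x d. dist (g k y) (h y) < \<epsilon>"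
        unfolding eventually_sequentially by blast
    qed
    with d(1) sub L(2)[of n] show "\<exists>d>0. cball x d \<subseteq> \<Omega> \<and> uniform_limit (cball x d) g h sequentially" by blast
  qed
  then have "h \<in> hol_space \<Omega>" by (simp add: hol_space_def h_def)
  with bound show ?thesis by blast
qed

lemma Baire_hol_space:
  fixes U :: "nat \<Rightarrow> (complex \<Rightarrow> complex) set"
  assumes \<Omega>: "open \<Omega>" and U: "\<And>n. hol_open \<Omega> (U n)" "\<And>n. hol_dense \<Omega> (U n)"
  shows "hol_dense \<Omega> (\<Inter>n. U n)"
  unfolding hol_dense_def
proof (intro ballI allI impI)
  fix f K and \<epsilon> :: real assume f: "f \<in> hol_space \<Omega>" and K: "compact K" "K \<subseteq> \<Omega>" and "\<epsilon> > 0"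
  \<comment> \<open>A state is a centre, a compact set and a tolerance. The start at
    \<open>f\<close> is encoded in \<open>P\<close> at stage 0, as dependent choice only yields some
    initial state with \<open>P 0\<close>. In \<open>Q n\<close>, it is the ball of stage
    \<open>n + 1\<close> that lies in \<open>U n\<close>.\<close>
  define P where "P = (\<lambda>n (g, L, e). g \<in> hol_space \<Omega> \<and> compact L \<and> L \<subseteq> \<Omega> \<and> exhaustion \<Omega> n \<subseteq> L \<and>
    0 < e \<and> e \<le> (1/2) ^ n \<and> (n = 0 \<longrightarrow> g = f \<and> K \<subseteq> L \<and> e < \<epsilon>))"
  define Q where "Q = (\<lambda>n (g, L, e) (g', L', e'). L \<subseteq> L' \<and> (\<forall>z\<in>L. dist (g' z) (g z) \<le> e / 2) \<and> e' \<le> e / 2 \<and>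
    {h \<in> hol_space \<Omega>. \<forall>z\<in>L'. dist (h z) (g' z) \<le> e'} \<subseteq> U n)"
  have P_iff: "P n (g, L, e) \<longleftrightarrow> g \<in> hol_space \<Omega> \<and> compact L \<and> L \<subseteq> \<Omega> \<and> exhaustion \<Omega> n \<subseteq> L \<and>
    0 < e \<and> e \<le> (1/2) ^ n \<and> (n = 0 \<longrightarrow> g = f \<and> K \<subseteq> L \<and> e < \<epsilon>)" for n g L e
    by (simp only: P_def prod.case)
  have Q_iff: "Q n (g, L, e) (g', L', e') \<longleftrightarrow> L \<subseteq> L' \<and> (\<forall>z\<in>L. dist (g' z) (g z) \<le> e / 2) \<and> e' \<le> e / 2 \<and>
    {h \<in> hol_space \<Omega>. \<forall>z\<in>L'. dist (h z) (g' z) \<le> e'} \<subseteq> U n" for n g L e g' L' e'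
    by (simp only: Q_def prod.case)
  have "\<exists>s. \<forall>n. P n (s n) \<and> Q n (s n) (s (Suc n))"
  proof (rule dependent_nat_choice)
    have "P 0 (f, K \<union> exhaustion \<Omega> 0, min 1 (\<epsilon> / 2))"
      unfolding P_iff using f K \<open>\<epsilon> > 0\<close>
      by (intro conjI impI compact_Un compact_exhaustion Un_least exhaustion_subset) auto
    then show "\<exists>x. P 0 x" ..
    fix x n assume "P n x"
    obtain g L e where x: "x = (g, L, e)" by (cases x)
    have x': "g \<in> hol_space \<Omega>" "compact L" "L \<subseteq> \<Omega>" "0 < e" "e \<le> (1/2) ^ n"
      using \<open>P n x\<close> unfolding x P_iff by blast+
    have "e / 2 > 0" using x'(4) by simp
    from U(2)[unfolded hol_dense_def, rule_format, OF x'(1-3) this]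
    obtain g' where g': "g' \<in> U n" "g' \<in> hol_space \<Omega>" "\<forall>z\<in>L. dist (g' z) (g z) < e / 2"
      by blast
    obtain M d where M: "compact M" "M \<subseteq> \<Omega>" "d > 0" "{h \<in> hol_space \<Omega>. \<forall>z\<in>M. dist (h z) (g' z) \<le> d} \<subseteq> U n"
      using hol_open_cball[OF U(1) g'(1)] by blast
    let ?L = "L \<union> M \<union> exhaustion \<Omega> (Suc n)" and ?e = "min d (e / 2)"
    have "{h \<in> hol_space \<Omega>. \<forall>z\<in>?L. dist (h z) (g' z) \<le> ?e} \<subseteq> {h \<in> hol_space \<Omega>. \<forall>z\<in>M. dist (h z) (g' z) \<le> d}"
      by simp blast
    then have "Q n x (g', ?L, ?e)"
      unfolding x Q_iff using g'(3) M(4) by (intro conjI) (blast, fastforce, simp, blast)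
    moreover have "P (Suc n) (g', ?L, ?e)"
      unfolding P_iff
    proof (intro conjI)
      show "compact ?L" "?L \<subseteq> \<Omega>"
        using x'(2,3) M(1,2) by (simp_all add: compact_Un compact_exhaustion exhaustion_subset)
      have "e / 2 \<le> (1/2) ^ Suc n" using x'(5) by simp
      then show "?e \<le> (1/2) ^ Suc n" by (rule min.coboundedI2)
    qed (use g'(2) x'(4) M(3) in auto)
    ultimately show "\<exists>y. P (Suc n) y \<and> Q n x y" by blast
  qed
  then obtain s where s: "\<forall>n. P n (s n) \<and> Q n (s n) (s (Suc n))" ..
  define g L e where "g n = fst (s n)" and "L n = fst (snd (s n))" and "e n = snd (snd (s n))" for n
  have s_eq: "s n = (g n, L n, e n)" for n by (simp add: g_def L_def e_def)
  have P: "P n (g n, L n, e n)" and Q: "Q n (g n, L n, e n) (g (Suc n), L (Suc n), e (Suc n))" for n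
    using s[rule_format, of n] unfolding s_eq by blast+
  note P' = P[unfolded P_iff] and Q' = Q[unfolded Q_iff]
  have "L n \<subseteq> L (Suc n)" for n using Q'[of n] by blast
  then have mono: "L n \<subseteq> L m" if "n \<le> m" for n m
    using that by (rule lift_Suc_mono_le)
  \<comment> \<open>The tolerances at least halve, so each move, at most \<open>e k / 2\<close>, is
    bounded by \<open>e k - e (Suc k)\<close>, and the bounds telescope.\<close>
  have step: "dist (g m z) (g n z) \<le> e n - e m" if "n \<le> m" "z \<in> L n" for n m z
    using that
  proof (induction m rule: dec_induct)
    case (step k)
    then have "z \<in> L k" using mono[of n k] by auto
    then have "dist (g (Suc k) z) (g k z) \<le> e k / 2" "e (Suc k) \<le> e k / 2"
      using Q'[of k] by blast+
    with step dist_triangle[of "g (Suc k) z" "g n z" "g k z"] show ?case by linarith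
  qed simp
  have e: "0 < e n" "e n \<le> (1/2) ^ n" for n using P'[of n] by blast+
  have "\<exists>h\<in>hol_space \<Omega>. \<forall>n. \<forall>z\<in>L n. dist (h z) (g n z) \<le> e n"
  proof (rule hol_space_locally_uniform_limit[OF \<Omega>])
    show "e \<longlonglongrightarrow> 0"
    proof (rule tendsto_sandwich[OF _ _ tendsto_const])
      show "(\<lambda>n. (1/2 :: real) ^ n) \<longlonglongrightarrow> 0" by (rule LIMSEQ_power_zero) simp
    qed (use e in \<open>auto simp: less_imp_le\<close>)
    show "dist (g m z) (g n z) \<le> e n" if "n \<le> m" "z \<in> L n" for m n z
      using step[OF that] e(1)[of m] by linarith
    show "L n \<subseteq> L m" if "n \<le> m" for m n by (rule mono[OF that])
  qed (use P' in blast)+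
  then obtain h where h: "h \<in> hol_space \<Omega>" "\<And>n z. z \<in> L n \<Longrightarrow> dist (h z) (g n z) \<le> e n" by blast
  then have "h \<in> U n" for n using Q'[of n] by blast
  moreover have "dist (h z) (f z) < \<epsilon>" if "z \<in> K" for z
  proof -
    have "z \<in> L 0" "g 0 = f" "e 0 < \<epsilon>" using P'[of 0] that by blast+
    with h(2)[of z 0] show ?thesis by simp
  qed
  ultimately show "\<exists>h\<in>(\<Inter>n. U n) \<inter> hol_space \<Omega>. \<forall>z\<in>K. dist (h z) (f z) < \<epsilon>"
    using h(1) by blast
qed

subsection \<open>The approximable functions as a countable intersection\<close>

lemma pade_error_mono: "K \<subseteq> L \<Longrightarrow> pade_error p q f K \<le> pade_error p q f L"
  unfolding pade_error_def by (intro SUP_subset_mono order_refl)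

lemma mem_pade_approximable_iff:
  "f \<in> pade_approximable \<Omega> \<F> \<longleftrightarrow> f \<in> hol_space \<Omega> \<and> (\<exists>p q. (\<forall>n. (p n, q n) \<in> \<F>) \<and>
     (\<forall>K. compact K \<and> K \<subseteq> \<Omega> \<longrightarrow> (\<exists>N. \<forall>n\<ge>N. \<forall>\<zeta>\<in>K. f \<in> pade_normal (p n) (q n) \<zeta>) \<and>
       (\<lambda>n. pade_error (p n) (q n) f K) \<longlonglongrightarrow> 0))"
  by (simp only: pade_approximable_def pade_error_def mem_Collect_eq)

text \<open>From the intersection, one pair per \<open>n\<close> forms the required sequence: a
  compact set lies in the exhausting sets from some \<open>N\<close> on, and there its error is at
  most \<open>1 / Suc n\<close>. Conversely, a late member of a given sequence serves the
  \<open>n\<close>th set.\<close>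

lemma pade_approximable_eq:
  assumes \<Omega>: "open \<Omega>"
  shows "pade_approximable \<Omega> \<F> =
    (\<Inter>n. \<Union>(p, q)\<in>\<F>. pade_close \<Omega> (exhaustion \<Omega> n) (ennreal (1 / Suc n)) p q)"
    (is "_ = (\<Inter>n. ?U n)")
proof (intro equalityI subsetI)
  fix f assume "f \<in> pade_approximable \<Omega> \<F>"
  then have f: "f \<in> hol_space \<Omega>" and "\<exists>p q. (\<forall>n. (p n, q n) \<in> \<F>) \<and>
     (\<forall>K. compact K \<and> K \<subseteq> \<Omega> \<longrightarrow> (\<exists>N. \<forall>n\<ge>N. \<forall>\<zeta>\<in>K. f \<in> pade_normal (p n) (q n) \<zeta>) \<and>
       (\<lambda>n. pade_error (p n) (q n) f K) \<longlonglongrightarrow> 0)"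
    unfolding mem_pade_approximable_iff by (rule conjunct1, rule conjunct2)
  then obtain p q where pq: "\<forall>n. (p n, q n) \<in> \<F>"
    and K: "\<forall>K. compact K \<and> K \<subseteq> \<Omega> \<longrightarrow> (\<exists>N. \<forall>n\<ge>N. \<forall>\<zeta>\<in>K. f \<in> pade_normal (p n) (q n) \<zeta>) \<and>
      (\<lambda>n. pade_error (p n) (q n) f K) \<longlonglongrightarrow> 0"
    by (elim exE conjE)
  have "f \<in> ?U n" for n
  proof -
    note Kn = K[rule_format, OF conjI[OF compact_exhaustion exhaustion_subset], of n]
    obtain N where N: "\<And>k \<zeta>. k \<ge> N \<Longrightarrow> \<zeta> \<in> exhaustion \<Omega> n \<Longrightarrow> f \<in> pade_normal (p k) (q k) \<zeta>"
      using Kn by blast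
    have "ennreal (1 / Suc n) > 0" by simp
    from order_tendstoD(2)[OF conjunct2[OF Kn] this] obtain M
      where M: "\<And>k. k \<ge> M \<Longrightarrow> pade_error (p k) (q k) f (exhaustion \<Omega> n) < ennreal (1 / Suc n)"
      unfolding eventually_sequentially by blast
    let ?k = "max M N"
    have "f \<in> pade_close \<Omega> (exhaustion \<Omega> n) (ennreal (1 / Suc n)) (p ?k) (q ?k)"
      unfolding pade_close_def mem_Collect_eq using f N[of ?k] M[of ?k] by simp
    with pq show ?thesis by blast
  qed
  then show "f \<in> (\<Inter>n. ?U n)" by blast
next
  fix f assume "f \<in> (\<Inter>n. ?U n)"
  then have "\<forall>n. \<exists>pq. pq \<in> \<F> \<and> f \<in> pade_close \<Omega> (exhaustion \<Omega> n) (ennreal (1 / Suc n)) (fst pq) (snd pq)"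
    by fastforce
  then obtain pq where pq: "\<And>n. pq n \<in> \<F>"
    "\<And>n. f \<in> pade_close \<Omega> (exhaustion \<Omega> n) (ennreal (1 / Suc n)) (fst (pq n)) (snd (pq n))" by metis
  let ?p = "\<lambda>n. fst (pq n)" and ?q = "\<lambda>n. snd (pq n)"
  have *: "(\<exists>N. \<forall>n\<ge>N. \<forall>\<zeta>\<in>K. f \<in> pade_normal (?p n) (?q n) \<zeta>) \<and> (\<lambda>n. pade_error (?p n) (?q n) f K) \<longlonglongrightarrow> 0"
    if K: "compact K" "K \<subseteq> \<Omega>" for K
  proof -
    obtain N where "K \<subseteq> interior (exhaustion \<Omega> N)" using compact_subset_interior_exhaustion[OF \<Omega> K] by blast
    then have sub: "K \<subseteq> exhaustion \<Omega> n" if "n \<ge> N" for n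
      using exhaustion_mono[OF that, of \<Omega>] interior_subset[of "exhaustion \<Omega> N"] by blast
    have "f \<in> pade_normal (?p n) (?q n) \<zeta>" if "n \<ge> N" "\<zeta> \<in> K" for n \<zeta>
      using pq(2)[of n] sub[OF that(1)] that(2) by (auto simp: pade_close_def)
    moreover have "(\<lambda>n. pade_error (?p n) (?q n) f K) \<longlonglongrightarrow> 0"
    proof (rule tendsto_sandwich[OF _ _ tendsto_const])
      have "(\<lambda>n. ennreal (1 / real (Suc n))) \<longlonglongrightarrow> ennreal 0"
        using LIMSEQ_inverse_real_of_nat by (intro tendsto_ennrealI) (simp add: inverse_eq_divide)
      then show "(\<lambda>n. ennreal (1 / real (Suc n))) \<longlonglongrightarrow> 0" by simp
      have "pade_error (?p n) (?q n) f K \<le> ennreal (1 / Suc n)" if "n \<ge> N" for n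
      proof -
        have "pade_error (?p n) (?q n) f (exhaustion \<Omega> n) < ennreal (1 / Suc n)"
          using pq(2)[of n] unfolding pade_close_def by blast
        with pade_error_mono[OF sub[OF that]] show ?thesis by (rule less_imp_le[OF le_less_trans])
      qed
      then show "\<forall>\<^sub>F n in sequentially. pade_error (?p n) (?q n) f K \<le> ennreal (1 / Suc n)"
        unfolding eventually_sequentially by blast
    qed simp
    ultimately show ?thesis by (intro conjI exI[of _ N] allI impI ballI)
  qed
  have "f \<in> hol_space \<Omega>" using pq(2)[of 0] unfolding pade_close_def by blast
  moreover have "\<forall>n. (?p n, ?q n) \<in> \<F>" using pq(1) by simp
  moreover have "\<forall>K. compact K \<and> K \<subseteq> \<Omega> \<longrightarrow> (\<exists>N. \<forall>n\<ge>N. \<forall>\<zeta>\<in>K. f \<in> pade_normal (?p n) (?q n) \<zeta>) \<and>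
      (\<lambda>n. pade_error (?p n) (?q n) f K) \<longlonglongrightarrow> 0"
    using * by (intro allI impI) (elim conjE)
  ultimately show "f \<in> pade_approximable \<Omega> \<F>"
    unfolding mem_pade_approximable_iff by (intro conjI exI[of _ ?p] exI[of _ ?q])
qed

theorem theorem3p7:
  fixes \<Omega> :: "complex set" and \<F> :: "(nat \<times> nat) set"
  assumes "open \<Omega>" and "sphere_simply_connected \<Omega>"
    and "\<exists>p q :: nat \<Rightarrow> nat. (\<forall>n. (p n, q n) \<in> \<F>) \<and> filterlim p at_top sequentially"
  shows "(\<exists>f. f \<in> pade_approximable \<Omega> \<F>) \<and>
    gdelta_in (hol_topology \<Omega>) (pade_approximable \<Omega> \<F>) \<and>
    hol_topology \<Omega> closure_of pade_approximable \<Omega> \<F> = hol_space \<Omega>"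
proof -
  define U where "U n = (\<Union>(p, q)\<in>\<F>. pade_close \<Omega> (exhaustion \<Omega> n) (ennreal (1 / Suc n)) p q)" for n
  have eq: "pade_approximable \<Omega> \<F> = (\<Inter>n. U n)"
    unfolding U_def by (rule pade_approximable_eq[OF assms(1)])
  have "openin (hol_topology \<Omega>) (pade_close \<Omega> (exhaustion \<Omega> n) (ennreal (1 / Suc n)) p q)" for n p q
    unfolding openin_hol_topology
    by (rule hol_open_pade_close[OF assms(1) compact_exhaustion exhaustion_subset])
  then have U: "openin (hol_topology \<Omega>) (U n)" for n
    unfolding U_def by (intro openin_Union) auto
  have dense: "hol_dense \<Omega> (U n)" for n
    unfolding hol_dense_def
  proof (intro ballI allI impI)
    fix f K and \<epsilon> :: real assume f: "f \<in> hol_space \<Omega>" and K: "compact K" "K \<subseteq> \<Omega>" and "\<epsilon> > 0"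
    have "poly_approximable K f"
      using f by (intro Runge_sphere_simply_connected[OF assms(1,2) _ K]) (simp add: hol_space_def)
    from Runge_large_degree[OF this K(1) \<open>\<epsilon> > 0\<close>] obtain N
      where N: "\<forall>p\<ge>N. \<exists>G. G \<noteq> 0 \<and> degree G = p \<and> (\<forall>z\<in>K. dist (poly G z) (f z) < \<epsilon>)" ..
    obtain p q :: "nat \<Rightarrow> nat" where pq: "\<forall>k. (p k, q k) \<in> \<F>" "filterlim p at_top sequentially"
      using assms(3) by (elim exE conjE)
    have "\<forall>\<^sub>F k in sequentially. N \<le> p k"
      using pq(2) unfolding filterlim_at_top by (rule spec)
    then obtain k where "p k \<ge> N"
      unfolding eventually_sequentially by (meson order_refl)
    with N obtain G where G: "G \<noteq> 0" "degree G = p k" "\<forall>z\<in>K. dist (poly G z) (f z) < \<epsilon>"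
      by blast
    have "ennreal (1 / Suc n) > 0" by simp
    from poly_in_pade_close[OF assms(1) exhaustion_subset this G(1), of n "q k"]
    have in_close: "restrict (poly G) \<Omega> \<in> pade_close \<Omega> (exhaustion \<Omega> n) (ennreal (1 / Suc n)) (p k) (q k)"
      unfolding G(2) .
    then have "restrict (poly G) \<Omega> \<in> U n \<inter> hol_space \<Omega>"
      using pq(1) unfolding U_def pade_close_def by blast
    moreover have "\<forall>z\<in>K. dist (restrict (poly G) \<Omega> z) (f z) < \<epsilon>"
      using G(3) K(2) by (simp add: subset_iff)
    ultimately show "\<exists>g\<in>U n \<inter> hol_space \<Omega>. \<forall>z\<in>K. dist (g z) (f z) < \<epsilon>" by blast
  qed
  have *: "hol_dense \<Omega> (\<Inter>n. U n)"
    by (rule Baire_hol_space[OF assms(1)]) (use U dense in \<open>auto simp: openin_hol_topology\<close>)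
  have "gdelta_in (hol_topology \<Omega>) (\<Inter>n. U n)"
    using U by (intro gdelta_in_Inter) (auto intro: open_imp_gdelta_in)
  \<comment> \<open>Existence follows from density near the zero function, with the empty compact
    set as the only constraint.\<close>
  moreover have "(\<lambda>z\<in>\<Omega>. 0) \<in> hol_space \<Omega>"
    using holomorphic_transform[of "\<lambda>z. 0" \<Omega> "\<lambda>z\<in>\<Omega>. 0"] by (simp add: hol_space_def)
  from *[unfolded hol_dense_def, rule_format, OF this, of "{}" 1] have "\<exists>f. f \<in> (\<Inter>n. U n)" by auto
  ultimately show ?thesis
    unfolding eq using closure_of_hol_dense[OF *] by blast
qed

end
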